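(* Let $\lambda(n)=(-1)^{\Omega(n)}$ be Liouville's function, where $\Omega(n)$ is the total number of prime factors of $n$ counted with multiplicity. Then the sequence $(\lambda(n))_{n\geq 1}$ is not $k$-automatic for any integer $k\geq 2$. Consequently, for every prime $p>2$, the formal power series $\sum_{n=1}^\infty \lambda(n)X^n\in\mathbb{F}_p[[X]]$ (coefficients read in $\mathbb{F}_p$) is transcendental over $\mathbb{F}_p(X)$.
   Context: A sequence $(t(n))_{n\geq 1}$ taking values in a finite set is called $k$-automatic (for an integer $k\geq 2$) if its $k$-kernel, the set of sequences $\{(t(k^l n+r))_{n}: l\geq 0,\ 0\leq r<k^l\}$, is finite. *)

theory Defs
  imports
    "HOL-Library.FuncSet"
    "HOL-Computational_Algebra.Computational_Algebra"
    "Berlekamp_Zassenhaus.Finite_Field"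
begin

definition big_omega :: "nat \<Rightarrow> nat" where
  "big_omega n = size (prime_factorization n)"

definition liouville :: "nat \<Rightarrow> int" where
  "liouville n = (-1) ^ big_omega n"

(* Sequences are indexed by n \<ge> 1.  Restricting to {1..} makes equality of functions coincide
   with equality of sequences and keeps the irrelevant value t 0 out of the kernel. *)
definition k_kernel :: "nat \<Rightarrow> (nat \<Rightarrow> 'a) \<Rightarrow> (nat \<Rightarrow> 'a) set" where
  "k_kernel k t = {restrict (\<lambda>n. t (k ^ l * n + r)) {1..} | l r. r < k ^ l}"

definition automatic :: "nat \<Rightarrow> (nat \<Rightarrow> 'a) \<Rightarrow> bool" where
  "automatic k t \<longleftrightarrow> finite (t ` {1..}) \<and> finite (k_kernel k t)"

(* The rational function field K(X), as a subfield of the Laurent series field K((X)). *)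
definition rational_functions :: "'a::field fls set" where
  "rational_functions =
     {fps_to_fls (fps_of_poly a) / fps_to_fls (fps_of_poly b) | a b. b \<noteq> 0}"

definition transcendental_over :: "'a::field set \<Rightarrow> 'a \<Rightarrow> bool" where
  "transcendental_over K x \<longleftrightarrow>
     \<not> (\<exists>P. P \<noteq> 0 \<and> (\<forall>i. Polynomial.coeff P i \<in> K) \<and> poly P x = 0)"

(* The constant coefficient must be set to 0 explicitly, since liouville 0 = 1. *)
definition liouville_fps :: "'a::comm_ring_1 fps" where
  "liouville_fps = Abs_fps (\<lambda>n. if n = 0 then 0 else of_int (liouville n))"

end

theory Submission
  imports Defs "HOL-Number_Theory.Number_Theory"
begin

text \<open>
  Suppose that \<open>f = \<lambda>\<close> is \<open>k\<close>-automatic. For a suitable power \<open>K\<close> of \<open>k\<close>, lengthening a block of zeros in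
  the base-\<open>K\<close> expansion of \<open>n\<close> does not change \<open>f n\<close>. Call two numbers equivalent if the
  cancellative multiplicative congruence generated by interchangeability of digit blocks identifies them.
  There are finitely many classes, \<open>f\<close> is constant on each, they form a group under multiplication, and
  concatenation across a long gap of zeros, \<open>s \<oplus> t\<close>, turns them into a finite semigroup on which this group acts
  transitively by automorphisms. Such a semigroup is a rectangular band: \<open>s \<oplus> t \<oplus> u = s \<oplus> u\<close>. Comparing \<open>c n\<close> and
  \<open>c (n + 1)\<close> just above a power of \<open>K\<close> shows that \<open>1 \<oplus> n\<close> does not depend on \<open>n\<close>, whence
  \<open>f (1 + q t) = 1\<close> for some \<open>q\<close> and all \<open>t \<ge> 1\<close>. A prime congruent to 1 modulo \<open>q\<close> contradicts this.

  Transcendence follows by Christol's argument: if \<open>F\<close> is algebraic over \<open>F_p(X)\<close>, it satisfies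
  \<open>\<Sum>i\<le>d. A i * F ^ (p ^ i) = 0\<close> with \<open>A 0 \<noteq> 0\<close>, and the series \<open>H\<close> for which \<open>A 0 * H\<close> is a combination of the
  \<open>F ^ (p ^ i)\<close> with coefficients of bounded degree form a finite set stable under the Cartier operators.
\<close>

section \<open>Automatic completely multiplicative functions\<close>

text \<open>Index \<open>i\<close> stands for the power \<open>x^(i+1)\<close> in a semigroup
  generated by one element, so \<open>E m (Suc (m + m))\<close> says that \<open>x^(m+1)\<close>
  equals its own square. A repetition among the powers forces such an idempotent.\<close>

lemma periodic_idempotent_index:
  fixes E :: "nat \<Rightarrow> nat \<Rightarrow> bool"
  assumes refl: "\<And>i. E i i"
    and trans: "\<And>i j l. E i j \<Longrightarrow> E j l \<Longrightarrow> E i l"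
    and shift: "\<And>i j n. E i j \<Longrightarrow> E (i + n) (j + n)"
    and ij: "i < j" "E i j"
  shows "\<exists>m. E m (Suc (m + m))"
proof -
  define p where "p = j - i"
  have p: "p > 0" "j = i + p" using ij by (auto simp: p_def)
  have step: "E m (m + r * p)" if "i \<le> m" for m r
  proof (induction r)
    case 0
    show ?case by (simp add: refl)
  next
    case (Suc r)
    have "E (i + (m + r * p - i)) (j + (m + r * p - i))"
      by (rule shift[OF ij(2)])
    moreover have "i + (m + r * p - i) = m + r * p" using that by simp
    moreover have "j + (m + r * p - i) = m + Suc r * p" using that p by simp
    ultimately have "E (m + r * p) (m + Suc r * p)" by simp
    with Suc.IH show ?case by (rule trans)
  qed
  \<comment> \<open>This makes \<open>m + 1\<close> a multiple of the period \<open>p\<close> with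
    \<open>i \<le> m\<close>; shifting \<open>m\<close> by that multiple gives
    \<open>2 * m + 1\<close>.\<close>
  define m where "m = Suc i * p - 1"
  have m: "Suc m = Suc i * p" using p by (simp add: m_def)
  have "Suc i * 1 \<le> Suc i * p" using p by (intro mult_le_mono) auto
  then have "i \<le> m" using m by simp
  from step[OF this, of "Suc i"] have "E m (Suc (m + m))"
    unfolding m[symmetric] by simp
  then show ?thesis by blast
qed

text \<open>Blocks are written from the low-order end: in \<open>u + K ^ a * x\<close> the block
  \<open>u\<close> precedes \<open>x\<close>. \<open>gap_Suc\<close> compares one separating zero
  with two, never with none, since the finiteness of the kernel only makes multiplication by
  \<open>K\<close> idempotent on it, not the identity.\<close>

locale gap_invariant =
  fixes f :: "nat \<Rightarrow> 'a::idom" and K :: nat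
  assumes K_ge_2: "2 \<le> K"
    and f_mult: "\<And>a b. 0 < a \<Longrightarrow> 0 < b \<Longrightarrow> f (a * b) = f a * f b"
    and f_nonzero: "\<And>n. 0 < n \<Longrightarrow> f n \<noteq> 0"
    and gap_Suc: "\<And>u a x. u < K ^ a \<Longrightarrow> 0 < x \<Longrightarrow> f (u + K ^ (a + 2) * x) = f (u + K ^ (a + 1) * x)"
    and finite_values: "finite (f ` {1..})"
    and finite_kernel: "finite {restrict (\<lambda>x. f (u + K ^ a * x)) {1..} | a u. u < K ^ a}"
begin

declare One_nat_def [simp del]

section \<open>Digit blocks in base \<open>K\<close> and gaps of zeros\<close>

lemma K_pos [simp]: "0 < K"
  using K_ge_2 by simp

text \<open>Every number bounds its own digit length. This allows \<open>sim\<close> and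
  \<open>\<oplus>\<close> to use \<open>n\<close> itself as the width of the block
  \<open>n\<close>.\<close>

lemma less_K_power: "n < K ^ n"
  using less_exp[of n] power_mono[of 2 K n] K_ge_2 by linarith

lemma less_K_power_mono: "u < K ^ a \<Longrightarrow> a \<le> b \<Longrightarrow> u < K ^ b"
  using power_increasing[of a b K] K_ge_2 by linarith

lemma append_less_K_power:
  assumes "u < K ^ a" "v < K ^ b" "a \<le> c"
  shows "u + K ^ c * v < K ^ (c + b)"
proof -
  have "u < K ^ c" using less_K_power_mono assms by blast
  then have "u + K ^ c * v < K ^ c * Suc v" by simp
  also have "\<dots> \<le> K ^ c * K ^ b" using assms by (intro mult_le_mono) auto
  finally show ?thesis by (simp add: power_add)
qed

lemma append_gap_less_K_power: "n < K ^ b \<Longrightarrow> n + K ^ (b + 1) * t < K ^ (b + 1 + t)"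
  by (rule append_less_K_power[OF _ less_K_power]) auto

lemma gap_mono:
  assumes "u < K ^ a" "a \<le> b" "0 < x"
  shows "f (u + K ^ (b + 1) * x) = f (u + K ^ (a + 1) * x)"
  using assms(2)
proof (induction b rule: dec_induct)
  case (step b)
  have "u < K ^ b" using less_K_power_mono step assms(1) by blast
  from gap_Suc[OF this assms(3)] step show ?case by (simp add: numeral_2_eq_2 One_nat_def)
qed simp

lemma gap:
  assumes "u < K ^ a" "u < K ^ b"
  shows "f (u + K ^ (a + 1) * x) = f (u + K ^ (b + 1) * x)"
proof (cases "x = 0")
  case False
  then show ?thesis
    using gap_mono[OF assms(1), of b x] gap_mono[OF assms(2), of a x] nat_le_linear[of a b] by force
qed simp

text \<open>\<^term>\<open>sim n m\<close>: in base \<^term>\<open>K\<close>, the digit blocks of \<^term>\<open>n\<close> and \<^term>\<open>m\<close> may be exchanged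
  whenever they are separated from the rest of the expansion by zeros.\<close>

definition sim :: "nat \<Rightarrow> nat \<Rightarrow> bool" where
  "sim n m \<longleftrightarrow> (\<forall>a u x. u < K ^ a \<longrightarrow>
     f (u + K ^ (a + 1) * (n + K ^ (n + 1) * x)) = f (u + K ^ (a + 1) * (m + K ^ (m + 1) * x)))"

text \<open>The prefix \<open>u\<close>, the zero and the block \<open>n\<close> together form one
  low-order block, to which \<open>gap\<close> applies.\<close>

lemma gap_context:
  assumes "u < K ^ a" "n < K ^ b" "n < K ^ c"
  shows "f (u + K ^ (a + 1) * (n + K ^ (b + 1) * x)) = f (u + K ^ (a + 1) * (n + K ^ (c + 1) * x))"
proof -
  have *: "u + K ^ (a + 1) * n < K ^ (a + 1 + b)" "u + K ^ (a + 1) * n < K ^ (a + 1 + c)"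
    using append_less_K_power[of u a n _ "a + 1"] assms by simp_all
  show ?thesis
    using gap[OF *, of x] by (simp add: algebra_simps power_add)
qed

lemma simD:
  assumes "sim n m" "u < K ^ a" "n < K ^ b" "m < K ^ c"
  shows "f (u + K ^ (a + 1) * (n + K ^ (b + 1) * x)) = f (u + K ^ (a + 1) * (m + K ^ (c + 1) * x))"
proof -
  have "f (u + K ^ (a + 1) * (n + K ^ (b + 1) * x)) = f (u + K ^ (a + 1) * (n + K ^ (n + 1) * x))"
    using gap_context assms(2,3) less_K_power by blast
  also have "\<dots> = f (u + K ^ (a + 1) * (m + K ^ (m + 1) * x))"
    using assms(1,2) unfolding sim_def by blast
  also have "\<dots> = f (u + K ^ (a + 1) * (m + K ^ (c + 1) * x))"
    using gap_context assms(2,4) less_K_power by blast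
  finally show ?thesis .
qed

lemma simI:
  assumes "n < K ^ b" "m < K ^ c"
    and "\<And>a u x. u < K ^ a \<Longrightarrow>
      f (u + K ^ (a + 1) * (n + K ^ (b + 1) * x)) = f (u + K ^ (a + 1) * (m + K ^ (c + 1) * x))"
  shows "sim n m"
  unfolding sim_def
proof (intro allI impI)
  fix a u x assume u: "u < K ^ a"
  show "f (u + K ^ (a + 1) * (n + K ^ (n + 1) * x)) = f (u + K ^ (a + 1) * (m + K ^ (m + 1) * x))"
    using gap_context[OF u assms(1) less_K_power] gap_context[OF u assms(2) less_K_power] assms(3)[OF u]
    by simp
qed

lemma sim_gap:
  assumes "n < K ^ b" "n < K ^ c"
  shows "sim (n + K ^ (b + 1) * t) (n + K ^ (c + 1) * t)"
proof (rule simI)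
  show "n + K ^ (b + 1) * t < K ^ (b + 1 + t)" "n + K ^ (c + 1) * t < K ^ (c + 1 + t)"
    using append_gap_less_K_power assms by blast+
  fix a u x assume u: "u < K ^ a"
  show "f (u + K ^ (a + 1) * (n + K ^ (b + 1) * t + K ^ (b + 1 + t + 1) * x)) =
        f (u + K ^ (a + 1) * (n + K ^ (c + 1) * t + K ^ (c + 1 + t + 1) * x))"
    \<comment> \<open>The second block \<open>t\<close> and all that follows it count as the
      tail.\<close>
    using gap_context[OF u assms, of "t + K ^ (t + 1) * x"] by (simp add: algebra_simps power_add)
qed

lemma sim_append_left:
  assumes "sim n m" "n < K ^ b" "m < K ^ c"
  shows "sim (n + K ^ (b + 1) * t) (m + K ^ (c + 1) * t)"
proof (rule simI)
  show "n + K ^ (b + 1) * t < K ^ (b + 1 + t)" "m + K ^ (c + 1) * t < K ^ (c + 1 + t)"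
    using append_gap_less_K_power assms by blast+
  fix a u x assume u: "u < K ^ a"
  show "f (u + K ^ (a + 1) * (n + K ^ (b + 1) * t + K ^ (b + 1 + t + 1) * x)) =
        f (u + K ^ (a + 1) * (m + K ^ (c + 1) * t + K ^ (c + 1 + t + 1) * x))"
    using simD[OF assms(1) u assms(2,3), of "t + K ^ (t + 1) * x"]
    by (simp add: algebra_simps power_add)
qed

text \<open>The factor \<open>K\<close> puts one more zero in front of the block and so only
  lengthens the preceding gap.\<close>

lemma sim_K_mult: "sim (K * n) n"
proof (rule simI)
  show "K * n < K ^ (n + 1)" "n < K ^ n" using less_K_power[of n] by (simp_all add: power_add)
  fix a u x assume u: "u < K ^ a"
  have "u < K ^ (a + 1)" by (rule less_K_power_mono[OF u]) simp
  from gap[OF this u, of "n + K ^ (n + 1) * x"]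
  show "f (u + K ^ (a + 1) * (K * n + K ^ (n + 1 + 1) * x)) = f (u + K ^ (a + 1) * (n + K ^ (n + 1) * x))"
    by (simp add: algebra_simps power_add)
qed

lemma sim_imp_f_eq:
  assumes "sim n m" "0 < n" "0 < m"
  shows "f n = f m"
proof -
  \<comment> \<open>With empty prefix and empty tail, the context still contributes one zero in
    front of the block, hence the factor \<open>K\<close>; it cancels because \<open>f K\<close> is
    nonzero.\<close>
  have "f (K * n) = f (K * m)"
    using simD[OF assms(1), of 0 0 n m 0] less_K_power by simp
  then show ?thesis using assms f_mult f_nonzero[of K] by simp
qed

text \<open>Inserting the block \<open>n\<close> maps the finite kernel \<open>S\<close> to itself,
  so only finitely many behaviours of blocks exist.\<close>

lemma sim_pigeonhole:
  fixes s :: "nat \<Rightarrow> nat"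
  assumes pos: "\<And>i. 0 < s i"
  shows "\<exists>i j. i < j \<and> sim (s i) (s j)"
proof -
  define S where "S = {restrict (\<lambda>x. f (u + K ^ a * x)) {1..} | a u. u < K ^ a}"
  \<comment> \<open>The value \<open>t n\<close> is recorded separately: it is the case
    \<open>x = 0\<close> of an empty tail, which functions restricted to \<open>{1..}\<close> do not
    see.\<close>
  define sig where "sig = (\<lambda>n. restrict (\<lambda>t. (restrict (\<lambda>x. t (n + K ^ (n + 1) * x)) {1..}, t n)) S)"
  have sig_mem: "sig n \<in> S \<rightarrow>\<^sub>E S \<times> f ` {1..}" if n: "0 < n" for n
  proof -
    have "(restrict (\<lambda>x. t (n + K ^ (n + 1) * x)) {1..}, t n) \<in> S \<times> f ` {1..}" if "t \<in> S" for t
    proof -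
      from that obtain a u where t: "t = restrict (\<lambda>x. f (u + K ^ a * x)) {1..}" and u: "u < K ^ a"
        by (auto simp: S_def)
      have less: "u + K ^ a * n < K ^ (a + (n + 1))"
        using append_less_K_power[OF u, of n "n + 1" a] less_K_power_mono[OF less_K_power, of n "n + 1"]
        by simp
      have "restrict (\<lambda>x. t (n + K ^ (n + 1) * x)) {1..}
          = restrict (\<lambda>x. f (u + K ^ a * n + K ^ (a + (n + 1)) * x)) {1..}"
        using n by (intro restrict_ext) (simp add: t algebra_simps power_add)
      then have "restrict (\<lambda>x. t (n + K ^ (n + 1) * x)) {1..} \<in> S"
        using less unfolding S_def by blast
      moreover have "t n \<in> f ` {1..}" using n by (auto simp: t Suc_le_eq One_nat_def)
      ultimately show ?thesis by blast
    qed
    then show ?thesis by (auto simp: sig_def)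
  qed
  have "finite (S \<rightarrow>\<^sub>E S \<times> f ` {1..})"
    using finite_kernel finite_values by (intro finite_PiE finite_cartesian_product) (auto simp: S_def)
  then have "finite (range (\<lambda>i. sig (s i)))"
    using sig_mem pos by (auto intro: finite_subset)
  then have "\<not> inj (\<lambda>i. sig (s i))"
    using finite_imageD by blast
  then obtain i j where ij: "i \<noteq> j" "sig (s i) = sig (s j)"
    by (auto simp: inj_def)
  have "sim n m" if eq: "sig n = sig m" and n: "0 < n" and m: "0 < m" for n m
    unfolding sim_def
  proof (intro allI impI)
    fix a u x assume u: "u < K ^ a"
    define t where "t = restrict (\<lambda>x. f (u + K ^ (a + 1) * x)) {1..}"
    have "u < K ^ (a + 1)" by (rule less_K_power_mono[OF u]) simp
    then have "t \<in> S" unfolding S_def t_def by blast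
    then have eq': "restrict (\<lambda>x. t (n + K ^ (n + 1) * x)) {1..} = restrict (\<lambda>x. t (m + K ^ (m + 1) * x)) {1..}"
      "t n = t m"
      using fun_cong[OF eq, of t] by (auto simp: sig_def)
    have "t (n + K ^ (n + 1) * x) = t (m + K ^ (m + 1) * x)"
    proof (cases "x = 0")
      case True
      then show ?thesis using eq'(2) by simp
    next
      case False
      then show ?thesis using fun_cong[OF eq'(1), of x] by simp
    qed
    then show "f (u + K ^ (a + 1) * (n + K ^ (n + 1) * x)) = f (u + K ^ (a + 1) * (m + K ^ (m + 1) * x))"
      using n m by (simp add: t_def)
  qed
  then have "sim (s i) (s j)" "sim (s j) (s i)" using ij pos by auto
  then show ?thesis using ij(1) by (meson nat_neq_iff)
qed

section \<open>The multiplicative congruence and concatenation of its classes\<close>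

inductive equiv :: "nat \<Rightarrow> nat \<Rightarrow> bool" (infix "\<approx>" 50) where
  equiv_sim: "0 < n \<Longrightarrow> 0 < m \<Longrightarrow> sim n m \<Longrightarrow> n \<approx> m"
| equiv_sym: "n \<approx> m \<Longrightarrow> m \<approx> n"
| equiv_trans [trans]: "n \<approx> m \<Longrightarrow> m \<approx> l \<Longrightarrow> n \<approx> l"
| equiv_mult: "0 < c \<Longrightarrow> n \<approx> m \<Longrightarrow> c * n \<approx> c * m"
| equiv_cancel: "0 < c \<Longrightarrow> c * n \<approx> c * m \<Longrightarrow> n \<approx> m"

lemma equiv_refl: "0 < n \<Longrightarrow> n \<approx> n"
  by (rule equiv_sim) (auto simp: sim_def)

lemma equiv_pos: "n \<approx> m \<Longrightarrow> 0 < n \<and> 0 < m"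
  by (induction rule: equiv.induct) auto

lemma equiv_mult_right: "0 < c \<Longrightarrow> n \<approx> m \<Longrightarrow> n * c \<approx> m * c"
  using equiv_mult[of c n m] by (simp add: mult.commute)

text \<open>Closing \<open>sim\<close> under multiplication and cancellation preserves the value of
  \<open>f\<close> because \<open>f\<close> is multiplicative and vanishes nowhere on positive
  numbers.\<close>

lemma equiv_imp_f_eq: "n \<approx> m \<Longrightarrow> f n = f m"
proof (induction rule: equiv.induct)
  case (equiv_mult c n m)
  then show ?case using f_mult equiv_pos by simp
next
  case (equiv_cancel c n m)
  then have "0 < n" "0 < m" using equiv_pos[OF equiv_cancel.hyps(2)] by auto
  then show ?case using equiv_cancel f_mult f_nonzero by simp
qed (auto intro: sim_imp_f_eq)

text \<open>The width \<open>s\<close> is one valid choice among many; by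
  \<open>append_equiv_cat\<close> every width that fits \<open>s\<close> gives the same
  class.\<close>

definition cat :: "nat \<Rightarrow> nat \<Rightarrow> nat" (infixr "\<oplus>" 65) where
  "s \<oplus> t = s + K ^ (s + 1) * t"

lemma cat_pos: "0 < s \<Longrightarrow> 0 < s \<oplus> t"
  by (simp add: cat_def)

lemma append_equiv_cat: "0 < s \<Longrightarrow> s < K ^ b \<Longrightarrow> s + K ^ (b + 1) * t \<approx> s \<oplus> t"
  unfolding cat_def by (intro equiv_sim sim_gap less_K_power) auto

text \<open>Both sides consist of the blocks \<open>s\<close>, \<open>t\<close>, \<open>u\<close> in
  this order; they differ only in the length of the second gap. The right-hand side corresponds to
  giving \<open>s \<oplus> t\<close> the width \<open>s + 1 + t\<close>.\<close>

lemma cat_assoc: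
  assumes "0 < s" "0 < t"
  shows "(s \<oplus> t) \<oplus> u \<approx> s \<oplus> (t \<oplus> u)"
proof -
  have "s \<oplus> t < K ^ (s + 1 + t)"
    unfolding cat_def by (rule append_gap_less_K_power[OF less_K_power])
  from append_equiv_cat[OF cat_pos[OF assms(1)] this, of u]
  have "(s \<oplus> t) + K ^ (s + 1 + t + 1) * u \<approx> (s \<oplus> t) \<oplus> u" .
  moreover have "K ^ (s + 1 + t + 1) = K ^ (s + 1) * K ^ (t + 1)"
    by (simp add: power_add)
  then have "(s \<oplus> t) + K ^ (s + 1 + t + 1) * u = s \<oplus> (t \<oplus> u)"
    unfolding cat_def by (simp only: distrib_left mult.assoc add.assoc)
  ultimately show ?thesis by (simp only: equiv_sym)
qed

text \<open>Widening the gap to suit \<open>c * s\<close> before multiplying prevents a carry into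
  the second block.\<close>

lemma cat_distrib:
  assumes "0 < c" "0 < s"
  shows "c * (s \<oplus> t) \<approx> c * s \<oplus> c * t"
proof -
  have "s \<le> c * s" using assms by simp
  then have "s < K ^ (c * s)" using less_K_power[of "c * s"] by linarith
  then have "c * (s + K ^ (c * s + 1) * t) \<approx> c * (s \<oplus> t)"
    using append_equiv_cat[OF assms(2)] equiv_mult[OF assms(1)] by blast
  moreover have "c * (s + K ^ (c * s + 1) * t) = c * s \<oplus> c * t"
    by (simp add: cat_def algebra_simps)
  ultimately show ?thesis by (simp only: equiv_sym)
qed

lemma sim_cat_left: "0 < n \<Longrightarrow> 0 < m \<Longrightarrow> sim n m \<Longrightarrow> n \<oplus> t \<approx> m \<oplus> t"
  unfolding cat_def by (intro equiv_sim sim_append_left less_K_power) auto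

text \<open>\<open>sim\<close> can be applied directly only to the left argument of
  \<open>\<oplus>\<close>. Multiplying by \<open>m\<close> creates a left argument \<open>m\<close>;
  exchanging it for \<open>n\<close> turns \<open>m * (c * n)\<close> into \<open>n\<close> times
  \<open>c * m\<close>, and the scaling is undone by cancellation.\<close>

lemma one_cat_sim:
  assumes "0 < n" "0 < m" "sim n m" "0 < c"
  shows "1 \<oplus> c * n \<approx> 1 \<oplus> c * m"
proof (rule equiv_cancel)
  have nm: "n \<approx> m" using assms equiv_sim by blast
  have "m * (1 \<oplus> c * n) \<approx> m * 1 \<oplus> m * (c * n)"
    by (rule cat_distrib) (use assms in auto)
  also have "m * 1 \<oplus> m * (c * n) \<approx> n \<oplus> m * (c * n)"
    by (rule equiv_sym) (use sim_cat_left[of n m] assms in simp)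
  also have "n \<oplus> m * (c * n) = n * 1 \<oplus> n * (c * m)" by (simp add: algebra_simps)
  also have "\<dots> \<approx> n * (1 \<oplus> c * m)"
    by (rule equiv_sym, rule cat_distrib) (use assms in auto)
  also have "\<dots> \<approx> m * (1 \<oplus> c * m)" using nm equiv_mult_right cat_pos by simp
  finally show "m * (1 \<oplus> c * n) \<approx> m * (1 \<oplus> c * m)" .
qed (use assms in auto)

text \<open>Two powers \<open>d ^ i\<close>, \<open>d ^ j\<close> are interchangeable by pigeonhole.
  After scaling by \<open>d ^ i\<close> they occur as left arguments of \<open>\<oplus>\<close>, so
  their quotient \<open>d ^ h\<close> can be absorbed without knowing yet that
  \<open>\<oplus>\<close> respects \<open>\<approx>\<close>.\<close>

lemma power_absorb:
  assumes "0 < d"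
  obtains h where "0 < h" "d ^ h \<approx> 1" "\<And>e. 0 < e \<Longrightarrow> 1 \<oplus> d ^ h * e \<approx> 1 \<oplus> e"
    "\<And>e. 0 < e \<Longrightarrow> d ^ h \<oplus> e \<approx> 1 \<oplus> e"
proof -
  obtain i j where ij: "i < j" "sim (d ^ i) (d ^ j)"
    using sim_pigeonhole[of "\<lambda>i. d ^ i"] assms by auto
  define h where "h = j - i"
  have dj: "d ^ j = d ^ i * d ^ h" and h: "0 < h"
    using ij by (simp_all add: h_def flip: power_add)
  have eq: "d ^ i \<approx> d ^ j" using ij assms equiv_sim by simp
  have 1: "d ^ h \<approx> 1"
    by (rule equiv_sym, rule equiv_cancel[of "d ^ i"]) (use eq dj assms in auto)
  have 2: "1 \<oplus> d ^ h * e \<approx> 1 \<oplus> e" if "0 < e" for e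
  proof (rule equiv_cancel)
    have "d ^ i * (1 \<oplus> d ^ h * e) \<approx> d ^ i * 1 \<oplus> d ^ i * (d ^ h * e)"
      using cat_distrib[of "d ^ i" 1] assms by simp
    also have "d ^ i * 1 \<oplus> d ^ i * (d ^ h * e) \<approx> d ^ j \<oplus> d ^ i * (d ^ h * e)"
      using sim_cat_left ij assms by simp
    also have "d ^ j \<oplus> d ^ i * (d ^ h * e) = d ^ j * 1 \<oplus> d ^ j * e"
      by (simp add: dj algebra_simps)
    also have "\<dots> \<approx> d ^ j * (1 \<oplus> e)" by (rule equiv_sym) (use cat_distrib[of "d ^ j" 1] assms in simp)
    also have "\<dots> \<approx> d ^ i * (1 \<oplus> e)" by (rule equiv_sym) (use eq equiv_mult_right cat_pos in simp)
    finally show "d ^ i * (1 \<oplus> d ^ h * e) \<approx> d ^ i * (1 \<oplus> e)" .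
  qed (use assms in auto)
  have 3: "d ^ h \<oplus> e \<approx> 1 \<oplus> e" if "0 < e" for e
  proof (rule equiv_cancel)
    have "d ^ i * (d ^ h \<oplus> e) \<approx> d ^ j \<oplus> d ^ i * e"
      using cat_distrib[of "d ^ i" "d ^ h" e] assms by (simp add: dj)
    also have "\<dots> \<approx> d ^ i \<oplus> d ^ i * e"
      by (rule equiv_sym) (use sim_cat_left[of "d ^ i" "d ^ j"] ij assms in simp)
    also have "d ^ i \<oplus> d ^ i * e \<approx> d ^ i * (1 \<oplus> e)"
      by (rule equiv_sym) (use cat_distrib[of "d ^ i" 1 e] assms in simp)
    finally show "d ^ i * (d ^ h \<oplus> e) \<approx> d ^ i * (1 \<oplus> e)" .
  qed (use assms in auto)
  show ?thesis using that h 1 2 3 by blast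
qed

text \<open>The multiplier \<open>c\<close> is generalised so that the multiplication rule can pass
  its factor into it; the cancellation rule is handled by absorbing a power of the cancelled
  factor.\<close>

lemma one_cat_cong:
  assumes "t \<approx> v" "0 < c"
  shows "1 \<oplus> c * t \<approx> 1 \<oplus> c * v"
  using assms
proof (induction arbitrary: c rule: equiv.induct)
  case (equiv_sim n m)
  then show ?case using one_cat_sim by blast
next
  case (equiv_sym n m)
  then show ?case using equiv.equiv_sym by blast
next
  case (equiv_trans n m l)
  then show ?case using equiv.equiv_trans by blast
next
  case (equiv_mult d n m)
  then show ?case using equiv_mult.IH[of "c * d"] by (simp add: mult.assoc)
next
  case (equiv_cancel d n m)
  then have pos: "0 < n" "0 < m" using equiv_pos[OF equiv_cancel.hyps(2)] by auto
  obtain h where h: "0 < h" "\<And>e. 0 < e \<Longrightarrow> 1 \<oplus> d ^ h * e \<approx> 1 \<oplus> e"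
    using power_absorb equiv_cancel by metis
  then obtain h' where "h = Suc h'" by (cases h) auto
  \<comment> \<open>Since \<open>h\<close> is positive, \<open>d ^ h\<close> supplies the factor
    \<open>d\<close> that the induction hypothesis requires.\<close>
  then have dh: "d ^ h * (c * x) = d ^ h' * c * (d * x)" for x by simp
  have "1 \<oplus> c * n \<approx> 1 \<oplus> d ^ h * (c * n)"
    by (rule equiv_sym) (use h(2) equiv_cancel pos in simp)
  also have "\<dots> \<approx> 1 \<oplus> d ^ h * (c * m)"
    unfolding dh using equiv_cancel by simp
  also have "\<dots> \<approx> 1 \<oplus> c * m"
    using h(2) equiv_cancel pos by simp
  finally show ?case .
qed

text \<open>A power of \<open>s\<close> is equivalent to 1, so a lower power is its inverse.
  Factoring out \<open>s\<close> reduces concatenation to left argument 1, where congruence is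
  known.\<close>

lemma obtain_inverse:
  assumes "0 < s"
  obtains s' where "0 < s'" "s * s' \<approx> 1" "\<And>t. 0 < t \<Longrightarrow> s \<oplus> t \<approx> s * (1 \<oplus> s' * t)"
proof -
  obtain h where h: "0 < h" "s ^ h \<approx> 1" "\<And>e. 0 < e \<Longrightarrow> s ^ h \<oplus> e \<approx> 1 \<oplus> e"
    using power_absorb assms by metis
  define s' where "s' = s ^ (h - 1)"
  have s': "0 < s'" "s * s' = s ^ h"
    using assms h(1) by (simp_all add: s'_def flip: power_Suc)
  have "s \<oplus> t \<approx> s * (1 \<oplus> s' * t)" if t: "0 < t" for t
  proof -
    have "s * s' * (s \<oplus> t) \<approx> 1 * (s \<oplus> t)"
      using equiv_mult_right[OF cat_pos[OF assms] h(2)] s' by simp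
    then have "s \<oplus> t \<approx> s * (s' * (s \<oplus> t))"
      by - (rule equiv_sym, simp add: mult.assoc)
    also have "\<dots> \<approx> s * (s' * s \<oplus> s' * t)"
      using cat_distrib equiv_mult assms s' by simp
    also have "s' * s = s ^ h" using s' by (simp add: mult.commute)
    also have "s * (s ^ h \<oplus> s' * t) \<approx> s * (1 \<oplus> s' * t)"
      using h(3) equiv_mult assms s' t by simp
    finally show ?thesis .
  qed
  then show ?thesis using that s' h by metis
qed

lemma cat_cong:
  assumes "s \<approx> s2" "t \<approx> t2"
  shows "s \<oplus> t \<approx> s2 \<oplus> t2"
proof -
  have pos: "0 < s" "0 < s2" "0 < t" "0 < t2" using assms equiv_pos by auto
  obtain r where r: "0 < r" "s * r \<approx> 1" "\<And>t. 0 < t \<Longrightarrow> s \<oplus> t \<approx> s * (1 \<oplus> r * t)"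
    using obtain_inverse pos by metis
  obtain r2 where r2: "0 < r2" "s2 * r2 \<approx> 1" "\<And>t. 0 < t \<Longrightarrow> s2 \<oplus> t \<approx> s2 * (1 \<oplus> r2 * t)"
    using obtain_inverse pos by metis
  \<comment> \<open>Equivalent elements have equivalent inverses, by the usual uniqueness argument
    in a commutative group.\<close>
  have "r \<approx> r * (s2 * r2)" by (rule equiv_sym) (use equiv_mult[OF r(1) r2(2)] in simp)
  also have "r * (s2 * r2) = s2 * (r * r2)" by simp
  also have "\<dots> \<approx> s * (r * r2)" by (rule equiv_sym) (use equiv_mult_right assms(1) r r2 in simp)
  also have "s * (r * r2) = r2 * (s * r)" by simp
  also have "\<dots> \<approx> r2" using equiv_mult[OF r2(1) r(2)] by simp
  finally have rr: "r \<approx> r2" .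
  have "s \<oplus> t \<approx> s * (1 \<oplus> r * t)" using r pos by simp
  also have "\<dots> \<approx> s * (1 \<oplus> r * t2)" using one_cat_cong assms(2) equiv_mult pos r by simp
  also have "\<dots> \<approx> s * (1 \<oplus> r2 * t2)"
    using one_cat_cong[OF rr, of t2] equiv_mult pos by (simp add: mult.commute)
  also have "\<dots> \<approx> s2 * (1 \<oplus> r2 * t2)" using assms(1) equiv_mult_right cat_pos by simp
  also have "\<dots> \<approx> s2 \<oplus> t2" by (rule equiv_sym) (use r2 pos in simp)
  finally show ?thesis .
qed

lemmas cat_cong_left = cat_cong[OF _ equiv_refl]
lemmas cat_cong_right = cat_cong[OF equiv_refl]

lemma K_power_mult_equiv: "0 < n \<Longrightarrow> K ^ j * n \<approx> n"
proof (induction j)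
  case (Suc j)
  have "K * (K ^ j * n) \<approx> K ^ j * n" using Suc by (intro equiv_sim sim_K_mult) auto
  also have "\<dots> \<approx> n" using Suc by simp
  finally show ?case by (simp add: mult.assoc)
qed (simp add: equiv_refl)

section \<open>The finite band of classes\<close>

text \<open>The classes form a finite semigroup under \<open>\<oplus>\<close>, on which multiplication acts transitively by
  automorphisms; as a finite semigroup contains an idempotent, all its elements are idempotent.\<close>

lemma one_cat_one: "1 \<oplus> 1 \<approx> 1"
proof -
  \<comment> \<open>\<open>e n\<close> is the concatenation of \<open>n + 1\<close> copies of 1,
    whence the index \<open>Suc (i + j)\<close> for \<open>e i \<oplus> e j\<close>.\<close>
  define e where "e = (\<lambda>n. ((\<oplus>) 1 ^^ n) 1)"
  have e_simps: "e 0 = 1" "e (Suc n) = 1 \<oplus> e n" for n by (simp_all add: e_def)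
  have e_pos: "0 < e n" for n by (induction n) (simp_all add: e_simps cat_pos)
  have e_cat: "e i \<oplus> e j \<approx> e (Suc (i + j))" for i j
  proof (induction i)
    case 0
    show ?case using equiv_refl e_pos by (simp add: e_simps cat_pos)
  next
    case (Suc i)
    have "e (Suc i) \<oplus> e j \<approx> 1 \<oplus> (e i \<oplus> e j)"
      using cat_assoc e_pos by (simp add: e_simps)
    also have "\<dots> \<approx> 1 \<oplus> e (Suc (i + j))" using Suc cat_cong_right by simp
    finally show ?case by (simp add: e_simps)
  qed
  obtain i j where ij: "i < j" "sim (e i) (e j)" using sim_pigeonhole e_pos by blast
  have "\<exists>m. e m \<approx> e (Suc (m + m))"
  proof (rule periodic_idempotent_index)
    show "e i \<approx> e i" for i using equiv_refl e_pos by blast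
    show "e i \<approx> e j \<Longrightarrow> e j \<approx> e l \<Longrightarrow> e i \<approx> e l" for i j l by (rule equiv_trans)
    show "e i \<approx> e j" using ij e_pos equiv_sim by blast
    show "e (i + n) \<approx> e (j + n)" if "e i \<approx> e j" for i j n
      by (induction n) (use that in \<open>simp_all add: e_simps cat_cong_right\<close>)
  qed (rule ij)
  then obtain m where m: "e m \<approx> e (Suc (m + m))" ..
  \<comment> \<open>Multiplication by the idempotent \<open>e m\<close> is an automorphism taking 1
    to it, so idempotency can be pulled back to 1.\<close>
  have "e m * (1 \<oplus> 1) \<approx> e m \<oplus> e m" using cat_distrib[of "e m" 1 1] e_pos by simp
  also have "\<dots> \<approx> e (Suc (m + m))" by (rule e_cat)
  also have "\<dots> \<approx> e m * 1" by (rule equiv_sym) (use m in simp)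
  finally show ?thesis using equiv_cancel e_pos by blast
qed

lemma cat_idem: "0 < s \<Longrightarrow> s \<oplus> s \<approx> s"
proof -
  assume s: "0 < s"
  have "s \<oplus> s \<approx> s * (1 \<oplus> 1)" by (rule equiv_sym) (use cat_distrib[of s 1 1] s in simp)
  also have "\<dots> \<approx> s" using equiv_mult[OF s one_cat_one] by simp
  finally show ?thesis .
qed

text \<open>The element \<open>x = 1 \<oplus> t \<oplus> 1\<close> lies below 1 in the natural order of the band; multiplying by powers
  of \<open>x\<close> gives a descending chain from 1 that returns to 1 because \<open>x\<close> has finite order.\<close>

lemma one_cat_cat_one:
  assumes t: "0 < t"
  shows "1 \<oplus> t \<oplus> 1 \<approx> 1"
proof -
  define x where "x = 1 \<oplus> t \<oplus> 1"
  have x: "0 < x" by (simp add: x_def cat_pos)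
  have "1 \<oplus> x \<approx> (1 \<oplus> 1) \<oplus> (t \<oplus> 1)"
    unfolding x_def by (rule equiv_sym) (use cat_assoc in simp)
  also have "\<dots> \<approx> x"
    unfolding x_def using cat_cong_left one_cat_one cat_pos t by simp
  finally have 1: "1 \<oplus> x \<approx> x" .
  have "x \<oplus> 1 \<approx> 1 \<oplus> ((t \<oplus> 1) \<oplus> 1)" unfolding x_def using cat_assoc cat_pos t by simp
  also have "\<dots> \<approx> 1 \<oplus> (t \<oplus> (1 \<oplus> 1))" using cat_cong_right cat_assoc t by simp
  also have "\<dots> \<approx> x" unfolding x_def using cat_cong_right one_cat_one t by simp
  finally have 2: "x \<oplus> 1 \<approx> x" .
  have 3: "x \<oplus> x ^ Suc j \<approx> x ^ Suc j" for j
  proof (induction j)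
    case 0
    show ?case using cat_idem x by simp
  next
    case (Suc j)
    have pos: "0 < x ^ n" for n using x by simp
    have "x ^ Suc j \<oplus> x ^ Suc (Suc j) \<approx> x ^ Suc j * (1 \<oplus> x)"
      by (rule equiv_sym) (use cat_distrib[of "x ^ Suc j" 1 x] x in \<open>simp add: mult.commute\<close>)
    also have "\<dots> \<approx> x ^ Suc j * x" using 1 equiv_mult pos by blast
    also have "x ^ Suc j * x = x ^ Suc (Suc j)" by simp
    finally have down: "x ^ Suc j \<oplus> x ^ Suc (Suc j) \<approx> x ^ Suc (Suc j)" .
    have "x \<oplus> x ^ Suc (Suc j) \<approx> x \<oplus> (x ^ Suc j \<oplus> x ^ Suc (Suc j))"
      by (rule equiv_sym) (use down cat_cong_right x in blast)
    also have "\<dots> \<approx> (x \<oplus> x ^ Suc j) \<oplus> x ^ Suc (Suc j)"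
      by (rule equiv_sym) (use cat_assoc pos x in blast)
    also have "\<dots> \<approx> x ^ Suc j \<oplus> x ^ Suc (Suc j)" using cat_cong_left Suc pos by blast
    also note down
    finally show ?case .
  qed
  obtain h where h: "0 < h" "x ^ h \<approx> 1" using power_absorb x by metis
  \<comment> \<open>With \<open>x ^ h \<approx> 1\<close>, fact \<open>2\<close> makes
    \<open>x \<oplus> 1\<close> equivalent to \<open>x\<close> while fact \<open>3\<close> makes it
    equivalent to 1.\<close>
  have "x \<approx> x \<oplus> 1" by (rule equiv_sym) (use 2 in blast)
  also have "\<dots> \<approx> x \<oplus> x ^ h" by (rule equiv_sym) (use cat_cong_right x h in blast)
  also have "\<dots> \<approx> x ^ h" using 3[of "h - 1"] h by simp
  also note h(2)
  finally show ?thesis by (simp add: x_def)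
qed

text \<open>Multiplication by \<open>s\<close> carries \<open>one_cat_cat_one\<close> from 1 to
  \<open>s\<close>, once \<open>t\<close> is written as \<open>s * (r * t)\<close> with
  \<open>r\<close> inverse to \<open>s\<close>.\<close>

lemma cat_cat_self:
  assumes "0 < s" "0 < t"
  shows "s \<oplus> t \<oplus> s \<approx> s"
proof -
  obtain r where r: "0 < r" "s * r \<approx> 1" using obtain_inverse assms by metis
  have "t \<approx> s * (r * t)"
    by (rule equiv_sym) (use equiv_mult_right[OF assms(2) r(2)] in \<open>simp add: mult.assoc\<close>)
  then have "s \<oplus> (t \<oplus> s) \<approx> s \<oplus> (s * (r * t) \<oplus> s)"
    using cat_cong_right cat_cong_left assms by blast
  also have "\<dots> \<approx> s \<oplus> s * (r * t \<oplus> 1)"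
    by (rule equiv_sym) (use cat_cong_right cat_distrib[of s "r * t" 1] r assms in simp)
  also have "\<dots> \<approx> s * (1 \<oplus> r * t \<oplus> 1)"
    by (rule equiv_sym) (use cat_distrib[of s 1] r assms in simp)
  also have "\<dots> \<approx> s"
    using one_cat_cat_one[of "r * t"] equiv_mult[of s] assms r by fastforce
  finally show ?thesis .
qed

text \<open>Expanding \<open>u\<close> to \<open>u \<oplus> s \<oplus> u\<close> encloses
  \<open>t \<oplus> u\<close> between two copies of \<open>s\<close>, and
  \<open>cat_cat_self\<close> collapses that part to \<open>s\<close>.\<close>

lemma cat_drop_middle:
  assumes "0 < s" "0 < t" "0 < u"
  shows "s \<oplus> t \<oplus> u \<approx> s \<oplus> u"
proof -
  have "s \<oplus> (t \<oplus> u) \<approx> s \<oplus> (t \<oplus> (u \<oplus> (s \<oplus> u)))"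
    by (rule equiv_sym) (use cat_cong_right cat_cat_self[of u s] assms in simp)
  also have "\<dots> \<approx> s \<oplus> ((t \<oplus> u) \<oplus> (s \<oplus> u))"
    by (rule equiv_sym) (use cat_cong_right cat_assoc assms in simp)
  also have "\<dots> \<approx> s \<oplus> (((t \<oplus> u) \<oplus> s) \<oplus> u)"
    by (rule equiv_sym) (use cat_cong_right cat_assoc cat_pos assms in simp)
  also have "\<dots> \<approx> (s \<oplus> ((t \<oplus> u) \<oplus> s)) \<oplus> u"
    by (rule equiv_sym) (use cat_assoc cat_pos assms in simp)
  also have "\<dots> \<approx> s \<oplus> u"
    using cat_cong_left cat_cat_self cat_pos assms by simp
  finally show ?thesis .
qed

section \<open>Multiples just above a power of \<open>K\<close>\<close>

text \<open>Since multiples \<open>c * n\<close> and \<open>c * (n + 1)\<close> slightly above a common power of \<^term>\<open>K\<close> both have leading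
  block 1, the class of \<open>1 \<oplus> n\<close> is the same for all large \<open>n\<close>.\<close>

lemma one_cat_Suc:
  assumes n: "2 * K \<le> n"
  shows "1 \<oplus> n \<approx> 1 \<oplus> Suc n"
proof -
  \<comment> \<open>\<open>c * n\<close> is the least multiple of \<open>n\<close> exceeding
    \<open>K ^ (b + 1)\<close>, and \<open>e\<close> is the excess. The hypothesis on
    \<open>n\<close> gives \<open>c \<le> K ^ b div 2 + 1\<close>, and \<open>b\<close> is large
    enough for both \<open>e\<close> and \<open>e + c\<close> to fit below \<open>K ^ b\<close>,
    leaving a zero before the leading 1.\<close>
  define b where "b = 2 * n + 4"
  define c where "c = K ^ (b + 1) div n + 1"
  define e where "e = n - K ^ (b + 1) mod n"
  have n0: "0 < n" using n K_ge_2 by simp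
  have e: "0 < e" "e \<le> n" using n0 by (auto simp: e_def)
  have "K ^ (b + 1) mod n + e = n"
    using mod_less_divisor[OF n0, of "K ^ (b + 1)"] by (simp add: e_def)
  then have "c * n = K ^ (b + 1) div n * n + K ^ (b + 1) mod n + e"
    by (simp only: c_def distrib_right mult_1 add.assoc)
  then have cn: "c * n = e + K ^ (b + 1) * 1" by simp
  then have cSn: "c * Suc n = (e + c) + K ^ (b + 1) * 1" by simp
  have "K ^ (b + 1) div n \<le> K ^ (b + 1) div (2 * K)"
    using n by (intro div_le_mono2) auto
  also have "K ^ (b + 1) = K ^ b * K" by (simp add: power_add)
  also have "K ^ b * K div (2 * K) = K ^ b div 2" by (rule div_mult_mult2) simp
  finally have c: "c \<le> K ^ b div 2 + 1" by (simp add: c_def power_add)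
  have "b < K ^ b" by (rule less_K_power)
  then have less: "e + c < K ^ b" "e < K ^ b" using c e by (auto simp: b_def)
  have c0: "0 < c" by (simp add: c_def)
  \<comment> \<open>\<open>c * k\<close> is the block \<open>e'\<close>, a gap and the digit 1; in
    \<open>c \<oplus> e' \<oplus> 1\<close> the middle term drops out, so \<open>k\<close> no longer
    matters.\<close>
  have cat_small: "c * (1 \<oplus> k) \<approx> c \<oplus> 1" if eq: "c * k = e' + K ^ (b + 1) * 1"
    and e': "0 < e'" "e' < K ^ b" for k e'
  proof -
    have "c * (1 \<oplus> k) \<approx> c \<oplus> c * k" using cat_distrib[of c 1 k] c0 by simp
    also have "\<dots> \<approx> c \<oplus> (e' \<oplus> 1)"
      unfolding eq using append_equiv_cat[OF e'] cat_cong_right c0 by blast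
    also have "\<dots> \<approx> c \<oplus> 1" using cat_drop_middle e' c0 by simp
    finally show ?thesis .
  qed
  have "c * (1 \<oplus> n) \<approx> c \<oplus> 1" using cat_small[OF cn] e less by blast
  also have "c \<oplus> 1 \<approx> c * (1 \<oplus> Suc n)" by (rule equiv_sym) (use cat_small[OF cSn] e less in simp)
  finally show ?thesis using equiv_cancel c0 by blast
qed

text \<open>Unit steps lead from \<open>n\<close> up to \<open>K ^ n\<close>, which is equivalent to
  1, and \<open>1 \<oplus> 1 \<approx> 1\<close>.\<close>

lemma one_cat_large:
  assumes n: "2 * K \<le> n"
  shows "1 \<oplus> n \<approx> 1"
proof -
  have "1 \<oplus> n \<approx> 1 \<oplus> (n + j)" for j
  proof (induction j)
    case 0
    show ?case by (simp add: equiv_refl cat_pos)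
  next
    case (Suc j)
    also have "1 \<oplus> (n + j) \<approx> 1 \<oplus> Suc (n + j)" using one_cat_Suc n by simp
    finally show ?case by simp
  qed
  from this[of "K ^ n - n"] have "1 \<oplus> n \<approx> 1 \<oplus> K ^ n"
    using less_K_power[of n] by simp
  also have "\<dots> \<approx> 1 \<oplus> 1" using K_power_mult_equiv[of 1 n] cat_cong_right by simp
  also note one_cat_one
  finally show ?thesis .
qed

theorem trivial_on_residue_class_one:
  "\<exists>q>0. \<forall>t>0. f (1 + q * t) = 1"
proof (intro exI conjI allI impI)
  \<comment> \<open>\<open>1 \<oplus> y\<close> is \<open>1 + K^2 * y\<close>; the further factor
    \<open>K ^ (2 * K)\<close> lifts \<open>y\<close> above the threshold of
    \<open>one_cat_large\<close> for every positive \<open>t\<close>.\<close>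
  show "0 < K ^ (2 + 2 * K)" by simp
  fix t :: nat assume "0 < t"
  have "2 * K < K ^ (2 * K)" by (rule less_K_power)
  also have "\<dots> \<le> K ^ (2 * K) * t" using \<open>0 < t\<close> by simp
  finally have "2 * K \<le> K ^ (2 * K) * t" by simp
  from one_cat_large[OF this] have "f (1 \<oplus> K ^ (2 * K) * t) = f 1" by (rule equiv_imp_f_eq)
  moreover have "f 1 = 1" using f_mult[of 1 1] f_nonzero[of 1] by simp
  ultimately show "f (1 + K ^ (2 + 2 * K) * t) = 1"
    by (simp add: cat_def power_add mult.assoc power2_eq_square)
qed

end

section \<open>From automaticity to gap invariance\<close>

lemma automatic_imp_gap_invariant:
  fixes f :: "nat \<Rightarrow> 'a::idom"
  assumes k: "2 \<le> k" and aut: "automatic k f"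
    and f_mult: "\<And>a b. 0 < a \<Longrightarrow> 0 < b \<Longrightarrow> f (a * b) = f a * f b"
    and f_nonzero: "\<And>n. 0 < n \<Longrightarrow> f n \<noteq> 0"
  shows "\<exists>K. gap_invariant f K"
proof -
  define S where "S = k_kernel k f"
  \<comment> \<open>\<open>c i\<close> is the self-map of the kernel that substitutes
    \<open>k ^ i * n\<close> for \<open>n\<close>, i.e. inserts \<open>i\<close> zeros. These maps
    form a finite semigroup generated by one element, so one with positive exponent is
    idempotent.\<close>
  define c where "c = (\<lambda>i. restrict (\<lambda>t. restrict (\<lambda>n. t (k ^ i * n)) {1..}) S)"
  have fin: "finite S" "finite (f ` {1..})" using aut by (auto simp: automatic_def S_def)
  have "restrict (\<lambda>n. t (k ^ i * n)) {1..} \<in> S" if "t \<in> S" for t i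
  proof -
    from that obtain l r where t: "t = restrict (\<lambda>n. f (k ^ l * n + r)) {1..}" and r: "r < k ^ l"
      by (auto simp: S_def k_kernel_def)
    have "restrict (\<lambda>n. t (k ^ i * n)) {1..} = restrict (\<lambda>n. f (k ^ (l + i) * n + r)) {1..}"
      using k by (intro restrict_ext) (auto simp: t power_add mult.assoc)
    moreover have "r < k ^ (l + i)" using r k power_increasing[of l "l + i" k] by linarith
    ultimately show ?thesis unfolding S_def k_kernel_def by blast
  qed
  then have "range (\<lambda>i. c (Suc i)) \<subseteq> S \<rightarrow>\<^sub>E S"
    unfolding c_def by (intro image_subsetI restrict_PiE_iff[THEN iffD2]) blast
  then have "finite (range (\<lambda>i. c (Suc i)))" using fin finite_PiE finite_subset by metis
  then have "\<not> inj (\<lambda>i. c (Suc i))" using finite_imageD by blast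
  then obtain i j where "i < j" "c (Suc i) = c (Suc j)"
    by (auto simp: inj_def) (metis nat_neq_iff)
  then have "\<exists>m. c (Suc m) = c (Suc (Suc (m + m)))"
  proof (rule_tac periodic_idempotent_index[where E = "\<lambda>i j. c (Suc i) = c (Suc j)" and i = i and j = j])
    fix i j n assume eq: "c (Suc i) = c (Suc j)"
    have "t (k ^ Suc (i + n) * x) = t (k ^ Suc (j + n) * x)" if "t \<in> S" "1 \<le> x" for t x
    proof -
      have "restrict (\<lambda>n. t (k ^ Suc i * n)) {1..} = restrict (\<lambda>n. t (k ^ Suc j * n)) {1..}"
        using fun_cong[OF eq, of t] that by (simp add: c_def)
      from fun_cong[OF this, of "k ^ n * x"] show ?thesis
        using that k by (simp add: power_add mult_ac)
    qed
    then show "c (Suc (i + n)) = c (Suc (j + n))" unfolding c_def by (intro restrict_ext) auto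
  qed auto
  then obtain m where m: "c (Suc m) = c (Suc (Suc (m + m)))" ..
  \<comment> \<open>Idempotency of \<open>c (Suc m)\<close> says that substituting
    \<open>K * n\<close> and \<open>K^2 * n\<close> has the same effect on the kernel; the positive
    exponent ensures \<open>2 \<le> K\<close>.\<close>
  define K where "K = k ^ Suc m"
  have Kpow: "K ^ a = k ^ (Suc m * a)" for a unfolding K_def by (rule power_mult[symmetric])
  have "k ^ 1 \<le> K" unfolding K_def using k by (intro power_increasing) auto
  then have K2: "2 \<le> K" using k by simp
  have sub: "{restrict (\<lambda>x. f (u + K ^ a * x)) {1..} | a u. u < K ^ a} \<subseteq> S"
    unfolding S_def k_kernel_def Kpow by (auto simp: add.commute)
  have "gap_invariant f K"
  proof
    fix u a x :: nat assume u: "u < K ^ a" and x: "0 < x"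
    define t where "t = restrict (\<lambda>x. f (u + K ^ a * x)) {1..}"
    have "t \<in> S" using sub u by (auto simp: t_def)
    then have "restrict (\<lambda>n. t (K * n)) {1..} = restrict (\<lambda>n. t (K ^ 2 * n)) {1..}"
      using fun_cong[OF m, of t] by (simp add: c_def K_def power2_eq_square power_add mult_ac)
    from fun_cong[OF this, of x] show "f (u + K ^ (a + 2) * x) = f (u + K ^ (a + 1) * x)"
      using x K2 by (simp add: t_def power_add mult_ac power2_eq_square)
  qed (use K2 f_mult f_nonzero fin finite_subset[OF sub] in auto)
  then show ?thesis ..
qed

section \<open>Primes congruent to 1\<close>

text \<open>A prime factor of \<open>X\<^sup>n - 1\<close> vanishing at a primitive \<open>n\<close>-th root of unity replaces the cyclotomic polynomial.\<close>

lemma prime_factor_of_power_minus_one: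
  fixes n :: nat
  assumes n: "0 < n"
  obtains m :: "int poly" where "m dvd Polynomial.monom 1 n - 1" "Polynomial.degree m > 0"
    "\<And>d e. n = d * e \<Longrightarrow> d < n \<Longrightarrow> m dvd (\<Sum>i<e. Polynomial.monom 1 (d * i))"
proof -
  define z where "z = cis (2 * pi / n)"
  define ev :: "int poly \<Rightarrow> complex" where "ev = (\<lambda>p. poly (of_int_poly p) z)"
  have ev_mult: "ev (p * q) = ev p * ev q" for p q by (simp add: ev_def hom_distribs)
  have ev_monom: "ev (Polynomial.monom 1 d - 1) = z ^ d - 1" for d
    by (simp add: ev_def hom_distribs poly_monom)
  have z: "z ^ d = cis (2 * pi * d / n)" for d
    by (simp add: z_def DeMoivre mult_ac)
  have zn: "z ^ n = 1" using n by (simp add: z)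
  have zd: "z ^ d \<noteq> 1" if d: "0 < d" "d < n" for d
  proof
    assume "z ^ d = 1"
    then have "cos (2 * pi * d / n) = 1" by (simp add: z complex_eq_iff)
    then obtain k :: int where "2 * pi * d / n = of_int k * 2 * pi" using cos_one_2pi_int by blast
    then have "real d = of_int k * real n" using n by (simp add: field_simps)
    then have "int d = k * int n" using of_int_eq_iff[where 'a = real] by (metis of_int_mult of_int_of_nat_eq)
    then have "n dvd d" using int_dvd_int_iff by (metis dvd_triv_right)
    then show False using d by (auto dest: dvd_imp_le)
  qed
  have nz: "(Polynomial.monom 1 n - 1 :: int poly) \<noteq> 0"
  proof
    assume "(Polynomial.monom 1 n - 1 :: int poly) = 0"
    then have "poly (Polynomial.monom 1 n - 1 :: int poly) 0 = 0" by simp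
    then show False using n by (simp add: poly_monom power_0_left)
  qed
  have "\<exists>m. m dvd p \<and> prime_elem m \<and> ev m = 0" if "p \<noteq> 0" "ev p = 0" for p
    using that
  proof (induction p rule: prime_divisors_induct)
    case zero
    then show ?case by simp
  next
    case (unit p)
    then obtain q where "1 = p * q" by (auto elim: dvdE)
    then have "ev p * ev q = 1" by (metis ev_mult ev_def of_int_poly_hom.hom_one poly_1)
    then show ?case using unit by simp
  next
    case (factor m p)
    show ?case
    proof (cases "ev m = 0")
      case True
      then show ?thesis using factor by (intro exI[of _ m]) auto
    next
      case False
      then obtain q where "q dvd p" "prime_elem q" "ev q = 0" using factor by (auto simp: ev_mult)
      then show ?thesis by (intro exI[of _ q]) auto
    qed
  qed
  from this[OF nz] obtain m where m: "m dvd Polynomial.monom 1 n - 1" "prime_elem m" "ev m = 0"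
    using zn ev_monom by auto
  have "Polynomial.degree m > 0"
  proof (rule ccontr)
    assume "\<not> Polynomial.degree m > 0"
    then obtain c where "m = [:c:]" by (auto elim: degree_eq_zeroE)
    moreover have "(of_int_poly [:c:] :: complex poly) = [:of_int c:]"
      by (rule poly_eqI) (simp add: coeff_map_poly coeff_pCons split: nat.splits)
    ultimately show False using m by (simp add: ev_def)
  qed
  moreover have "m dvd (\<Sum>i<e. Polynomial.monom 1 (d * i))" if nde: "n = d * e" "d < n" for d e
  proof -
    have "(Polynomial.monom 1 d - 1) * (\<Sum>i<e. Polynomial.monom 1 d ^ i) = (Polynomial.monom 1 d ^ e - 1 :: int poly)"
      by (simp add: power_diff_1_eq)
    then have "Polynomial.monom 1 n - 1 = (Polynomial.monom 1 d - 1) * (\<Sum>i<e. Polynomial.monom 1 (d * i) :: int poly)"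
      using nde by (simp add: monom_power)
    \<comment> \<open>By primality \<open>m\<close> divides one of the two factors; the first is
      excluded because it does not vanish at the primitive root \<open>z\<close>.\<close>
    then have "m dvd Polynomial.monom 1 d - 1 \<or> m dvd (\<Sum>i<e. Polynomial.monom 1 (d * i))"
      using m prime_elem_dvd_mult_iff by metis
    moreover have "\<not> m dvd Polynomial.monom 1 d - 1"
    proof
      assume "m dvd Polynomial.monom 1 d - 1"
      then obtain q where "Polynomial.monom 1 d - 1 = m * q" by (auto elim: dvdE)
      then have "ev (Polynomial.monom 1 d - 1) = ev m * ev q" by (simp add: ev_mult)
      then show False using m ev_monom zd[of d] nde n by (cases d) auto
    qed
    ultimately show ?thesis by blast
  qed
  ultimately show ?thesis using that m by blast
qed

text \<open>A prime \<open>p\<close> dividing the value of \<open>m\<close> at a multiple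
  \<open>a\<close> of \<open>n\<close> does not divide \<open>n\<close>, and modulo \<open>p\<close>
  the order of \<open>a\<close> is exactly \<open>n\<close>; by Fermat, \<open>n\<close> divides
  \<open>p - 1\<close>.\<close>

lemma exists_prime_cong_1:
  fixes n :: nat
  assumes n: "0 < n"
  shows "\<exists>p. prime p \<and> [p = 1] (mod n)"
proof -
  obtain m :: "int poly" where m: "m dvd Polynomial.monom 1 n - 1" "Polynomial.degree m > 0"
    "\<And>d e. n = d * e \<Longrightarrow> d < n \<Longrightarrow> m dvd (\<Sum>i<e. Polynomial.monom 1 (d * i))"
    using prime_factor_of_power_minus_one n by blast
  \<comment> \<open>A nonconstant polynomial takes the values 1 and -1 only finitely often, so some
    multiple of \<open>n\<close> gives a value with a prime divisor.\<close>
  have "finite {x. poly (m - [:1:]) x = 0}" "finite {x. poly (m + [:1:]) x = 0}"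
    using m(2) by (intro poly_roots_finite; auto simp: eq_neg_iff_add_eq_0[symmetric])+
  then have "finite ({x. poly (m - [:1:]) x = 0} \<union> {x. poly (m + [:1:]) x = 0})" by simp
  moreover have "infinite ((\<lambda>x. int n * int x) ` {2..})"
    using n by (subst finite_image_iff) (auto simp: inj_on_def infinite_Ici)
  ultimately obtain x where x: "x \<ge> 2" "poly m (int n * int x) \<noteq> 1" "poly m (int n * int x) \<noteq> -1"
    using finite_subset[of "(\<lambda>x. int n * int x) ` {2..}" "{x. poly (m - [:1:]) x = 0} \<union> {x. poly (m + [:1:]) x = 0}"]
    by (auto simp: eq_neg_iff_add_eq_0)
  define a where "a = n * x"
  have "\<bar>poly m (int a)\<bar> \<noteq> 1" using x by (auto simp: a_def)
  then have "nat \<bar>poly m (int a)\<bar> \<noteq> 1" by linarith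
  then obtain p where p: "prime p" "p dvd nat \<bar>poly m (int a)\<bar>"
    using prime_factor_nat by blast
  then have p_dvd: "int p dvd poly m (int a)" by simp
  have dvd_eval: "int p dvd poly q (int a)" if "m dvd q" for q
    using p_dvd that by (auto elim!: dvdE simp: mult.assoc)
  have "int p dvd int a ^ n - 1" using dvd_eval[OF m(1)] by (simp add: poly_monom)
  then have an: "[a ^ n = 1] (mod p)"
    by (metis cong_iff_dvd_diff cong_int_iff of_nat_1 of_nat_power)
  have pn: "\<not> p dvd n"
  proof
    assume "p dvd n"
    then have "p dvd a ^ n" using n by (simp add: a_def prime_dvd_power_iff p)
    then have "p dvd 1" using an cong_dvd_iff by blast
    then show False using p by simp
  qed
  have "coprime a p"
    using cong_imp_coprime[OF cong_sym[OF an]] n by simp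
  define d where "d = ord p a"
  have "d dvd n" using an unfolding d_def ord_divides .
  then obtain e where e: "n = d * e" by (auto elim: dvdE)
  have "d = n"
  proof (rule ccontr)
    assume "d \<noteq> n"
    then have "d < n" using \<open>d dvd n\<close> n by (simp add: dvd_imp_le le_neq_implies_less)
    have "int p dvd (\<Sum>i<e. int a ^ (d * i))"
      using dvd_eval[OF m(3)[OF e \<open>d < n\<close>]] by (simp add: poly_sum poly_monom)
    then have "p dvd (\<Sum>i<e. a ^ (d * i))" by (simp flip: of_nat_power of_nat_sum)
    \<comment> \<open>Each summand is 1 modulo \<open>p\<close>, so the sum is \<open>e\<close>
      modulo \<open>p\<close>; then \<open>p\<close> would divide \<open>e\<close> and hence
      \<open>n\<close>.\<close>
    moreover have "[(\<Sum>i<e. a ^ (d * i)) = (\<Sum>i<e. 1)] (mod p)"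
    proof (rule cong_sum)
      fix i
      show "[a ^ (d * i) = 1] (mod p)"
        using cong_pow[of "a ^ d" 1 p i] ord[of a p] by (simp add: d_def power_mult)
    qed
    ultimately have "p dvd e" using cong_dvd_iff by fastforce
    then show False using pn e by simp
  qed
  moreover have "[a ^ (p - 1) = 1] (mod p)"
    using fermat_theorem[of p a] p \<open>coprime a p\<close> by (metis coprime_commute coprime_absorb_left not_prime_unit)
  ultimately have "n dvd p - 1" unfolding d_def ord_divides by simp
  then have "[p = 1] (mod n)" using p prime_gt_0_nat[of p] by (simp add: cong_altdef_nat)
  then show ?thesis using p by blast
qed

section \<open>Algebraic power series over prime fields\<close>

text \<open>Fraction-free Gaussian elimination: a pivot \<open>v k j\<close> removes one equation
  and one unknown.\<close>

lemma homogeneous_system_nontrivial_solution: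
  fixes v :: "'i \<Rightarrow> 'j \<Rightarrow> 'a::idom"
  assumes "finite J" "finite I" "card J < card I"
  shows "\<exists>c. (\<exists>i\<in>I. c i \<noteq> 0) \<and> (\<forall>j\<in>J. (\<Sum>i\<in>I. c i * v i j) = 0)"
  using assms
proof (induction J arbitrary: I v rule: finite_induct)
  case empty
  then have "I \<noteq> {}" by auto
  then show ?case by (intro exI[of _ "\<lambda>_. 1"]) auto
next
  case (insert j J)
  show ?case
  proof (cases "\<forall>i\<in>I. v i j = 0")
    case True
    have "card J < card I" using insert by simp
    from insert.IH[OF insert.prems(1) this, of v] True show ?thesis by auto
  next
    case False
    then obtain k where k: "k \<in> I" "v k j \<noteq> 0" by blast
    have "card J < card (I - {k})" using insert k by simp
    from insert.IH[OF _ this, of "\<lambda>i l. v k j * v i l - v i j * v k l"] insert.prems(1)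
    obtain c where c: "\<exists>i\<in>I - {k}. c i \<noteq> 0"
      "\<And>l. l \<in> J \<Longrightarrow> (\<Sum>i\<in>I - {k}. c i * (v k j * v i l - v i j * v k l)) = 0"
      by auto
    \<comment> \<open>The other unknowns are scaled by the pivot so that the value at
      \<open>k\<close> solving equation \<open>j\<close> needs no division.\<close>
    define c' where "c' = (\<lambda>i. if i = k then - (\<Sum>i\<in>I - {k}. c i * v i j) else v k j * c i)"
    have split: "(\<Sum>i\<in>I. c' i * v i l) =
        (\<Sum>i\<in>I - {k}. v k j * c i * v i l) - (\<Sum>i\<in>I - {k}. c i * v i j) * v k l" for l
    proof -
      have "(\<Sum>i\<in>I. c' i * v i l) = c' k * v k l + (\<Sum>i\<in>I - {k}. c' i * v i l)"
        using k insert.prems(1) by (simp add: sum.remove)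
      also have "(\<Sum>i\<in>I - {k}. c' i * v i l) = (\<Sum>i\<in>I - {k}. v k j * c i * v i l)"
        by (rule sum.cong) (auto simp: c'_def)
      finally show ?thesis by (simp add: c'_def)
    qed
    have "(\<Sum>i\<in>I. c' i * v i j) = 0"
      unfolding split by (simp add: sum_distrib_left sum_distrib_right mult_ac)
    moreover have "(\<Sum>i\<in>I. c' i * v i l) = 0" if "l \<in> J" for l
      using c(2)[OF that] unfolding split
      by (simp add: sum_distrib_left sum_distrib_right sum_subtractf algebra_simps)
    moreover have "\<exists>i\<in>I. c' i \<noteq> 0" using c(1) k by (auto simp: c'_def)
    ultimately show ?thesis by blast
  qed
qed

text \<open>The relation rewrites the top power \<open>F ^ Suc n\<close> by lower ones up to the
  factor \<open>Q (Suc n)\<close>; the polynomial \<open>c\<close> collects these factors in place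
  of denominators.\<close>

lemma algebraic_power_reduction:
  fixes F :: "'a::field fps" and Q :: "nat \<Rightarrow> 'a poly"
  assumes Q: "Q (Suc n) \<noteq> 0" and rel: "(\<Sum>j\<le>Suc n. fps_of_poly (Q j) * F ^ j) = 0"
  shows "\<exists>c B. c \<noteq> 0 \<and> fps_of_poly c * F ^ m = (\<Sum>j\<le>n. fps_of_poly (B j) * F ^ j)"
proof (induction m)
  case 0
  have "(\<Sum>j\<le>n. fps_of_poly (if j = 0 then 1 else 0) * F ^ j) = (\<Sum>j\<le>n. if j = 0 then 1 else 0)"
    by (rule sum.cong) auto
  then show ?case by (intro exI[of _ 1] exI[of _ "\<lambda>j. if j = 0 then 1 else 0"]) simp
next
  case (Suc m)
  then obtain c B where c: "c \<noteq> 0" and B: "fps_of_poly c * F ^ m = (\<Sum>j\<le>n. fps_of_poly (B j) * F ^ j)"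
    by blast
  define B' where "B' = (\<lambda>j. Q (Suc n) * (if j = 0 then 0 else B (j - 1)) - B n * Q j)"
  have *: "fps_of_poly (Q (Suc n)) * F ^ Suc n = - (\<Sum>j\<le>n. fps_of_poly (Q j) * F ^ j)"
    using rel by (simp add: eq_neg_iff_add_eq_0 add.commute)
  have shift: "(\<Sum>j\<le>n. fps_of_poly (if j = 0 then 0 else B (j - 1)) * F ^ j)
      + fps_of_poly (B n) * F ^ Suc n = (\<Sum>j\<le>n. fps_of_poly (B j) * F ^ Suc j)"
  proof -
    have "(\<Sum>j\<le>n. fps_of_poly (if j = 0 then 0 else B (j - 1)) * F ^ j)
      + fps_of_poly (B n) * F ^ Suc n = (\<Sum>j\<le>Suc n. fps_of_poly (if j = 0 then 0 else B (j - 1)) * F ^ j)"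
      by simp
    also have "\<dots> = (\<Sum>j\<le>n. fps_of_poly (B j) * F ^ Suc j)"
      by (subst sum.atMost_Suc_shift) simp
    finally show ?thesis .
  qed
  have "fps_of_poly (c * Q (Suc n)) * F ^ Suc m = fps_of_poly (Q (Suc n)) * (F * (fps_of_poly c * F ^ m))"
    by (simp add: fps_of_poly_mult mult_ac)
  also have "F * (fps_of_poly c * F ^ m) = (\<Sum>j\<le>n. fps_of_poly (B j) * F ^ Suc j)"
    by (simp add: B sum_distrib_left mult_ac)
  also have "\<dots> = (\<Sum>j\<le>n. fps_of_poly (if j = 0 then 0 else B (j - 1)) * F ^ j)
      + fps_of_poly (B n) * F ^ Suc n" using shift by simp
  also have "fps_of_poly (Q (Suc n)) * \<dots> =
      fps_of_poly (Q (Suc n)) * (\<Sum>j\<le>n. fps_of_poly (if j = 0 then 0 else B (j - 1)) * F ^ j)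
      + fps_of_poly (B n) * (fps_of_poly (Q (Suc n)) * F ^ Suc n)"
    by (simp only: distrib_left mult_ac)
  also have "\<dots> = (\<Sum>j\<le>n. fps_of_poly (B' j) * F ^ j)"
    unfolding * B'_def fps_of_poly_diff fps_of_poly_mult left_diff_distrib sum_subtractf
    by (simp add: sum_distrib_left mult.assoc)
  finally show ?case using c Q by (intro exI[of _ "c * Q (Suc n)"] exI[of _ B']) simp
qed

text \<open>The \<open>n + 1\<close> chosen powers all lie in the span of \<open>n\<close> powers
  over the rational functions. For \<open>n = 0\<close> the hypotheses contradict each
  other.\<close>

lemma algebraic_dependent_powers:
  fixes F :: "'a::field fps" and Q :: "nat \<Rightarrow> 'a poly" and e :: "nat \<Rightarrow> nat"
  assumes Q: "Q n \<noteq> 0" and rel: "(\<Sum>j\<le>n. fps_of_poly (Q j) * F ^ j) = 0"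
  shows "\<exists>A. (\<exists>i\<le>n. A i \<noteq> 0) \<and> (\<Sum>i\<le>n. fps_of_poly (A i) * F ^ e i) = 0"
proof (cases n)
  case 0
  then show ?thesis using Q rel by simp
next
  case (Suc n')
  have "\<forall>i. \<exists>c B. c \<noteq> 0 \<and> fps_of_poly c * F ^ e i = (\<Sum>j\<le>n'. fps_of_poly (B j) * F ^ j)"
    using algebraic_power_reduction[of Q n' F] Q rel Suc by blast
  then obtain c B where c: "\<And>i. c i \<noteq> 0"
    and B: "\<And>i. fps_of_poly (c i) * F ^ e i = (\<Sum>j\<le>n'. fps_of_poly (B i j) * F ^ j)"
    by metis
  obtain d where d: "\<exists>i\<in>{..n}. d i \<noteq> 0" "\<And>j. j \<in> {..n'} \<Longrightarrow> (\<Sum>i\<in>{..n}. d i * B i j) = 0"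
    using homogeneous_system_nontrivial_solution[of "{..n'}" "{..n}" B] Suc by force
  have "(\<Sum>i\<le>n. fps_of_poly (d i * c i) * F ^ e i)
      = (\<Sum>i\<le>n. \<Sum>j\<le>n'. fps_of_poly (d i * B i j) * F ^ j)"
    by (simp add: fps_of_poly_mult mult.assoc B sum_distrib_left)
  also have "\<dots> = (\<Sum>j\<le>n'. fps_of_poly (\<Sum>i\<le>n. d i * B i j) * F ^ j)"
    by (subst sum.swap) (simp add: fps_of_poly_sum sum_distrib_right)
  also have "\<dots> = 0" using d(2) by simp
  finally show ?thesis using d(1) c by (intro exI[of _ "\<lambda>i. d i * c i"]) auto
qed

section \<open>Frobenius and the Cartier operators\<close>

lemma mod_ring_power_CARD: "(x :: 'p::prime_card mod_ring) ^ CARD('p) = x"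
proof -
  have "of_nat n ^ CARD('p) = (of_nat n :: 'p mod_ring)" for n
  proof (induction n)
    case (Suc n)
    have "(1 + of_nat n :: 'p mod_ring) ^ CARD('p) = 1 ^ CARD('p) + of_nat n ^ CARD('p)"
      by (rule freshmans_dream) (simp_all add: prime_card)
    with Suc show ?case by simp
  qed simp
  moreover have "to_int_mod_ring x \<ge> 0"
    using range_to_int_mod_ring[where 'a = 'p] rangeI[of to_int_mod_ring x] by auto
  then have "of_nat (nat (to_int_mod_ring x)) = (of_int (to_int_mod_ring x) :: 'p mod_ring)"
    by simp
  then have "of_nat (nat (to_int_mod_ring x)) = x"
    unfolding of_int_of_int_mod_ring by simp
  ultimately show ?thesis by metis
qed

text \<open>This is \<open>F(X)^p = F(X^p)\<close>. Splitting off the terms below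
  \<open>m = n + 1\<close> leaves a finite sum for the freshman's dream and a tail too high to reach
  coefficient \<open>n\<close>.\<close>

lemma fps_nth_power_CARD:
  fixes F :: "'p::prime_card mod_ring fps"
  shows "(F ^ CARD('p)) $ n = (if CARD('p) dvd n then F $ (n div CARD('p)) else 0)"
proof -
  let ?p = "CARD('p)"
  have p: "?p > 0" by simp
  define m where "m = Suc n"
  have F: "F = (\<Sum>i<m. fps_const (F $ i) * fps_X ^ i) + fps_X ^ m * fps_shift m F"
    by (rule fps_ext) (auto simp: fps_sum_nth if_distrib sum.delta fps_X_power_mult_nth cong: if_cong)
  have "F ^ ?p = (\<Sum>i<m. fps_const (F $ i) * fps_X ^ i) ^ ?p + (fps_X ^ m * fps_shift m F) ^ ?p"
    by (subst F, rule freshmans_dream) (simp_all add: prime_card)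
  also have "(\<Sum>i<m. fps_const (F $ i) * fps_X ^ i) ^ ?p = (\<Sum>i<m. (fps_const (F $ i) * fps_X ^ i) ^ ?p)"
    by (rule freshmans_dream_sum) (simp_all add: prime_card)
  also have "\<dots> = (\<Sum>i<m. fps_const (F $ i) * fps_X ^ (i * ?p))"
    by (simp add: power_mult_distrib fps_const_power mod_ring_power_CARD power_mult)
  also have "(fps_X ^ m * fps_shift m F) ^ ?p = fps_X ^ (m * ?p) * fps_shift m F ^ ?p"
    by (simp add: power_mult_distrib power_mult)
  finally have "(F ^ ?p) $ n = (\<Sum>i<m. (fps_const (F $ i) * fps_X ^ (i * ?p)) $ n)
      + (fps_X ^ (m * ?p) * fps_shift m F ^ ?p) $ n"
    by (simp add: fps_sum_nth)
  also have "(fps_X ^ (m * ?p) * fps_shift m F ^ ?p) $ n = 0"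
  proof -
    have "m * 1 \<le> m * ?p" using p by (intro mult_le_mono) auto
    then have "n < m * ?p" by (simp add: m_def)
    then show ?thesis by (simp add: fps_X_power_mult_nth)
  qed
  also have "(\<Sum>i<m. (fps_const (F $ i) * fps_X ^ (i * ?p)) $ n) = (\<Sum>i<m. if n = i * ?p then F $ i else 0)"
    by (rule sum.cong) auto
  also have "\<dots> = (if ?p dvd n then F $ (n div ?p) else 0)"
  proof (cases "?p dvd n")
    case True
    then obtain q where q: "n = q * ?p" by (metis dvd_div_mult_self)
    then have "q < m" using p by (simp add: m_def le_imp_less_Suc)
    have "(\<Sum>i<m. if n = i * ?p then F $ i else 0) = (\<Sum>i<m. if i = q then F $ i else 0)"
      using p q by (intro sum.cong) auto
    with \<open>q < m\<close> q p show ?thesis by simp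
  next
    case False
    then have "n \<noteq> i * ?p" for i by auto
    with False show ?thesis by simp
  qed
  finally show ?thesis by simp
qed

definition cartier :: "nat \<Rightarrow> 'p::prime_card mod_ring fps \<Rightarrow> 'p mod_ring fps" where
  "cartier r F = Abs_fps (\<lambda>n. F $ (CARD('p) * n + r))"

lemma cartier_nth [simp]: "cartier r (F :: 'p::prime_card mod_ring fps) $ n = F $ (CARD('p) * n + r)"
  by (simp add: cartier_def)

lemma cartier_0 [simp]: "cartier r 0 = 0"
  by (rule fps_ext) simp

lemma cartier_sum: "cartier r (\<Sum>i\<in>I. F i) = (\<Sum>i\<in>I. cartier r (F i))"
  by (rule fps_ext) (simp add: fps_sum_nth)

text \<open>\<open>G ^ p\<close> involves only exponents divisible by \<open>p\<close>, so it passes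
  through the operator as a scalar would.\<close>

lemma cartier_mult_power_CARD:
  fixes F G :: "'p::prime_card mod_ring fps"
  assumes r: "r < CARD('p)"
  shows "cartier r (F * G ^ CARD('p)) = cartier r F * G"
proof (rule fps_ext)
  fix n
  let ?p = "CARD('p)"
  have p: "?p > 0" by simp
  let ?h = "\<lambda>i. (G ^ ?p) $ i * F $ (?p * n + r - i)"
  have "cartier r (F * G ^ ?p) $ n = (G ^ ?p * F) $ (?p * n + r)"
    by (simp add: mult.commute)
  also have "\<dots> = (\<Sum>i=0..?p * n + r. ?h i)"
    by (simp add: fps_mult_nth)
  also have "\<dots> = (\<Sum>i\<in>(\<lambda>j. ?p * j) ` {0..n}. ?h i)"
  proof (rule sum.mono_neutral_right)
    show "(\<lambda>j. ?p * j) ` {0..n} \<subseteq> {0..?p * n + r}" by (auto intro!: trans_le_add1 mult_le_mono)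
    show "\<forall>i\<in>{0..?p * n + r} - (\<lambda>j. ?p * j) ` {0..n}. ?h i = 0"
    proof
      fix i assume i: "i \<in> {0..?p * n + r} - (\<lambda>j. ?p * j) ` {0..n}"
      have "\<not> ?p dvd i"
      proof
        assume "?p dvd i"
        then obtain j where j: "i = ?p * j" by (auto elim: dvdE)
        then have "?p * j < ?p * Suc n" using i r by simp
        then have "j \<le> n" unfolding mult_less_cancel1 by simp
        then show False using i j by auto
      qed
      then show "?h i = 0" by (simp add: fps_nth_power_CARD)
    qed
  qed simp
  also have "\<dots> = (\<Sum>j=0..n. ?h (?p * j))"
    using p by (subst sum.reindex) (auto simp: inj_on_def)
  also have "\<dots> = (\<Sum>j=0..n. G $ j * cartier r F $ (n - j))"
  proof (rule sum.cong)
    fix j assume "j \<in> {0..n}"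
    then have "?p * n + r - ?p * j = ?p * (n - j) + r" by (simp add: diff_mult_distrib2)
    then show "?h (?p * j) = G $ j * cartier r F $ (n - j)" using p by (simp add: fps_nth_power_CARD)
  qed simp
  also have "\<dots> = (cartier r F * G) $ n" by (simp add: fps_mult_nth mult.commute)
  finally show "cartier r (F * G ^ ?p) $ n = (cartier r F * G) $ n" .
qed

text \<open>The operator divides degree bounds by \<open>p\<close>, which compensates for the growth
  caused later by clearing the denominator \<open>A 0\<close>.\<close>

lemma cartier_fps_of_poly:
  fixes A :: "'p::prime_card mod_ring poly"
  assumes "Polynomial.degree A \<le> CARD('p) * N"
  obtains B where "cartier r (fps_of_poly A) = fps_of_poly B" "Polynomial.degree B \<le> N"
proof
  define B where "B = (\<Sum>i\<le>N. Polynomial.monom (Polynomial.coeff A (CARD('p) * i + r)) i)"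
  have B: "Polynomial.coeff B i = (if i \<le> N then Polynomial.coeff A (CARD('p) * i + r) else 0)" for i
    by (simp add: B_def coeff_sum)
  show "Polynomial.degree B \<le> N" by (rule degree_le) (simp add: B)
  show "cartier r (fps_of_poly A) = fps_of_poly B"
  proof (rule fps_ext)
    fix i
    have "Polynomial.coeff A (CARD('p) * i + r) = 0" if "\<not> i \<le> N"
    proof (rule coeff_eq_0)
      have "CARD('p) * N < CARD('p) * i" using that by simp
      then show "Polynomial.degree A < CARD('p) * i + r" using assms by linarith
    qed
    then show "cartier r (fps_of_poly A) $ i = fps_of_poly B $ i" by (simp add: B)
  qed
qed

lemma cartier_nonzero:
  fixes F :: "'p::prime_card mod_ring fps"
  assumes "F \<noteq> 0"
  obtains r where "r < CARD('p)" "cartier r F \<noteq> 0"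
proof -
  obtain n where n: "F $ n \<noteq> 0" using assms by (auto simp: fps_eq_iff)
  have "cartier (n mod CARD('p)) F $ (n div CARD('p)) \<noteq> 0" using n by simp
  then have "cartier (n mod CARD('p)) F \<noteq> 0" by (metis fps_zero_nth)
  then show ?thesis using that[of "n mod CARD('p)"] by simp
qed

text \<open>In a relation of least length \<open>d\<close> the coefficient \<open>A 0\<close> cannot
  vanish: otherwise all remaining powers of \<open>F\<close> are \<open>p\<close>-th powers, and a
  Cartier operator not killing some \<open>A (Suc i)\<close> yields a shorter relation.\<close>

lemma ore_relation:
  fixes F :: "'p::prime_card mod_ring fps" and Q :: "nat \<Rightarrow> 'p mod_ring poly"
  assumes "Q n \<noteq> 0" "(\<Sum>j\<le>n. fps_of_poly (Q j) * F ^ j) = 0"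
  shows "\<exists>d A. A 0 \<noteq> 0 \<and> (\<Sum>i\<le>d. fps_of_poly (A i) * F ^ (CARD('p) ^ i)) = 0"
proof -
  let ?p = "CARD('p)"
  define R where "R = (\<lambda>d. \<exists>A. (\<exists>i\<le>d. A i \<noteq> 0) \<and> (\<Sum>i\<le>d. fps_of_poly (A i) * F ^ (?p ^ i)) = 0)"
  have "R n" unfolding R_def using algebraic_dependent_powers[OF assms] by blast
  then have "R (LEAST d. R d)" by (rule LeastI)
  then obtain d A where d: "d = (LEAST d. R d)" and nz: "\<exists>i\<le>d. A i \<noteq> 0"
    and rel: "(\<Sum>i\<le>d. fps_of_poly (A i) * F ^ (?p ^ i)) = 0"
    unfolding R_def by blast
  have "A 0 \<noteq> 0"
  proof
    assume A0: "A 0 = 0"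
    with nz obtain i where i: "Suc i \<le> d" "A (Suc i) \<noteq> 0" by (metis not0_implies_Suc)
    then obtain d' where d': "d = Suc d'" by (cases d) auto
    have "fps_of_poly (A (Suc i)) \<noteq> 0" using i by simp
    then obtain r where r: "r < ?p" "cartier r (fps_of_poly (A (Suc i))) \<noteq> 0"
      by (rule cartier_nonzero)
    have "\<exists>B. cartier r (fps_of_poly (A (Suc j))) = fps_of_poly B" for j
      using cartier_fps_of_poly[of "A (Suc j)" "Polynomial.degree (A (Suc j))" r] by auto
    then obtain B where B: "\<And>j. cartier r (fps_of_poly (A (Suc j))) = fps_of_poly (B j)" by metis
    have "0 = (\<Sum>i\<le>d'. fps_of_poly (A (Suc i)) * (F ^ (?p ^ i)) ^ ?p)"
      using rel A0 unfolding d' by (subst (asm) sum.atMost_Suc_shift) (simp add: mult.commute flip: power_mult)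
    then have "0 = cartier r (\<Sum>i\<le>d'. fps_of_poly (A (Suc i)) * (F ^ (?p ^ i)) ^ ?p)" by simp
    also have "\<dots> = (\<Sum>i\<le>d'. fps_of_poly (B i) * F ^ (?p ^ i))"
      by (simp add: cartier_sum cartier_mult_power_CARD r B)
    finally have "R d'"
      unfolding R_def using r B i d' by (intro exI[of _ B]) auto
    then have "d \<le> d'" unfolding d by (rule Least_le)
    then show False using d' by simp
  qed
  then show ?thesis using rel by blast
qed

section \<open>Finiteness of the decimations of an algebraic series\<close>

lemma finite_bounded_degree_polys: "finite {p :: 'a::{finite,comm_semiring_0} poly. Polynomial.degree p \<le> N}"
proof (rule finite_subset)
  show "{p :: 'a poly. Polynomial.degree p \<le> N} \<subseteq> Poly ` {xs. set xs \<subseteq> UNIV \<and> length xs \<le> Suc N}"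
  proof
    fix p :: "'a poly" assume "p \<in> {p. Polynomial.degree p \<le> N}"
    then have "length (coeffs p) \<le> Suc N" by (cases "p = 0") (auto simp: length_coeffs_degree)
    then show "p \<in> Poly ` {xs. set xs \<subseteq> UNIV \<and> length xs \<le> Suc N}"
      by (intro image_eqI[of _ _ "coeffs p"]) auto
  qed
  show "finite (Poly ` {xs :: 'a list. set xs \<subseteq> UNIV \<and> length xs \<le> Suc N})"
    by (intro finite_imageI finite_lists_length_le) simp
qed

lemma algebraic_imp_finite_decimations:
  fixes F :: "'p::prime_card mod_ring fps" and Q :: "nat \<Rightarrow> 'p mod_ring poly"
  assumes "Q n \<noteq> 0" "(\<Sum>j\<le>n. fps_of_poly (Q j) * F ^ j) = 0"
  shows "finite {Abs_fps (\<lambda>m. F $ (CARD('p) ^ l * m + r)) | l r. r < CARD('p) ^ l}"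
proof -
  let ?p = "CARD('p)"
  have p2: "2 \<le> ?p" using prime_card[where 'a = 'p] prime_ge_2_nat by blast
  obtain d A where A0: "A 0 \<noteq> 0" and rel: "(\<Sum>i\<le>d. fps_of_poly (A i) * F ^ (?p ^ i)) = 0"
    using ore_relation[OF assms] by blast
  define N where "N = Max ((\<lambda>i. Polynomial.degree (A i)) ` {..d})"
  have N: "Polynomial.degree (A i) \<le> N" if "i \<le> d" for i using that by (auto simp: N_def)
  define comb where "comb = (\<lambda>C. \<Sum>i\<le>d. fps_of_poly (C i) * F ^ (?p ^ i))"
  define S where "S = {H. \<exists>C. (\<forall>i\<le>d. Polynomial.degree (C i) \<le> N) \<and> fps_of_poly (A 0) * H = comb C}"
  have "finite S"
  proof (rule finite_subset)
    show "S \<subseteq> (\<lambda>C. comb C / fps_of_poly (A 0)) ` ({..d} \<rightarrow>\<^sub>E {q. Polynomial.degree q \<le> N})"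
    proof
      fix H assume "H \<in> S"
      then obtain C where C: "\<forall>i\<le>d. Polynomial.degree (C i) \<le> N" "fps_of_poly (A 0) * H = comb C"
        by (auto simp: S_def)
      have "comb (restrict C {..d}) = fps_of_poly (A 0) * H" using C(2) by (simp add: comb_def)
      then have "H = comb (restrict C {..d}) / fps_of_poly (A 0)" using A0 by simp
      moreover have "restrict C {..d} \<in> {..d} \<rightarrow>\<^sub>E {q. Polynomial.degree q \<le> N}" using C(1) by auto
      ultimately show "H \<in> (\<lambda>C. comb C / fps_of_poly (A 0)) ` ({..d} \<rightarrow>\<^sub>E {q. Polynomial.degree q \<le> N})"
        by blast
    qed
    show "finite ((\<lambda>C. comb C / fps_of_poly (A 0)) ` ({..d} \<rightarrow>\<^sub>E {q. Polynomial.degree q \<le> N}))"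
      by (intro finite_imageI finite_PiE finite_bounded_degree_polys) simp
  qed
  have S_cartier: "cartier r H \<in> S" if H: "H \<in> S" and r: "r < ?p" for H r
  proof -
    obtain C where C: "\<forall>i\<le>d. Polynomial.degree (C i) \<le> N" "fps_of_poly (A 0) * H = comb C"
      using H by (auto simp: S_def)
    \<comment> \<open>The factor \<open>A 0 ^ (p - 1)\<close> turns \<open>A 0\<close> into a
      \<open>p\<close>-th power that passes through the operator. Subtracting a multiple of the
      relation removes the term in \<open>F\<close> itself, leaving only \<open>p\<close>-th powers.
      Both parts have degree at most \<open>p * N\<close>, which the operator brings back to
      \<open>N\<close>.\<close>
    define D where "D = (\<lambda>i. A 0 ^ (?p - 1) * C i - A 0 ^ (?p - 2) * C 0 * A i)"
    have D0: "D 0 = 0"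
    proof -
      have "?p - 1 = Suc (?p - 2)" using p2 by simp
      then show ?thesis by (simp add: D_def)
    qed
    have degD: "Polynomial.degree (D i) \<le> ?p * N" if i: "i \<le> d" for i
    proof -
      have deg_pow: "Polynomial.degree (A 0 ^ m) \<le> m * N" for m
        using degree_power_le[of "A 0" m] mult_le_mono2[OF N[of 0], of m]
        by (metis le0 le_trans mult.commute)
      have "Polynomial.degree (A 0 ^ (?p - 1) * C i) \<le> (?p - 1) * N + N"
        using degree_mult_le[of "A 0 ^ (?p - 1)" "C i"] deg_pow[of "?p - 1"] C(1) i
        by (meson add_mono le_trans)
      also have "\<dots> = ?p * N" using p2 by (simp add: algebra_simps)
      finally have 1: "Polynomial.degree (A 0 ^ (?p - 1) * C i) \<le> ?p * N" .
      have "Polynomial.degree (A 0 ^ (?p - 2) * C 0 * A i) \<le> (?p - 2) * N + N + N"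
        using degree_mult_le[of "A 0 ^ (?p - 2) * C 0" "A i"] degree_mult_le[of "A 0 ^ (?p - 2)" "C 0"]
          deg_pow[of "?p - 2"] C(1) N i
        by (meson add_mono le_trans le0)
      also have "\<dots> = ?p * N"
        using p2 by (metis add.assoc add_mult_distrib le_add_diff_inverse2 mult_2)
      finally show ?thesis using 1 unfolding D_def by (rule degree_diff_le[rotated])
    qed
    have "\<exists>B. i \<le> d \<longrightarrow> cartier r (fps_of_poly (D i)) = fps_of_poly B \<and> Polynomial.degree B \<le> N" for i
      using cartier_fps_of_poly[OF degD] by metis
    then obtain B where B: "\<And>i. i \<le> d \<Longrightarrow> cartier r (fps_of_poly (D i)) = fps_of_poly (B i) \<and> Polynomial.degree (B i) \<le> N"
      by metis
    have "fps_of_poly (A 0) * cartier r H = cartier r (H * fps_of_poly (A 0) ^ ?p)"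
      using r by (simp add: cartier_mult_power_CARD mult.commute)
    also have "H * fps_of_poly (A 0) ^ ?p = fps_of_poly (A 0 ^ (?p - 1)) * (fps_of_poly (A 0) * H)"
    proof -
      have "fps_of_poly (A 0) ^ ?p = fps_of_poly (A 0) ^ (?p - 1) * fps_of_poly (A 0)"
        by (rule power_minus_mult[symmetric]) simp
      then show ?thesis by (simp only: fps_of_poly_power mult_ac)
    qed
    also have "\<dots> = fps_of_poly (A 0 ^ (?p - 1)) * comb C - fps_of_poly (A 0 ^ (?p - 2) * C 0) * comb A"
      using C(2) rel by (simp add: comb_def)
    also have "\<dots> = comb D"
      unfolding comb_def D_def fps_of_poly_diff fps_of_poly_mult left_diff_distrib sum_subtractf
      by (simp add: sum_distrib_left mult.assoc)
    finally have eq: "fps_of_poly (A 0) * cartier r H = cartier r (comb D)" .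
    show ?thesis
    proof (cases d)
      case 0
      then have "comb D = 0" using D0 by (simp add: comb_def)
      then have "fps_of_poly (A 0) * cartier r H = comb (\<lambda>_. 0)" using eq by (simp add: comb_def)
      then show ?thesis unfolding S_def by (intro CollectI exI[of _ "\<lambda>_. 0"]) simp
    next
      case (Suc d')
      define E where "E = (\<lambda>i. if i \<le> d' then B (Suc i) else 0)"
      have "comb D = (\<Sum>i\<le>d'. fps_of_poly (D (Suc i)) * (F ^ (?p ^ i)) ^ ?p)"
        unfolding comb_def Suc by (subst sum.atMost_Suc_shift) (simp add: D0 mult.commute flip: power_mult)
      then have "cartier r (comb D) = (\<Sum>i\<le>d'. cartier r (fps_of_poly (D (Suc i))) * F ^ (?p ^ i))"
        using r by (simp add: cartier_sum cartier_mult_power_CARD)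
      also have "\<dots> = (\<Sum>i\<le>d'. fps_of_poly (E i) * F ^ (?p ^ i))"
        using B Suc by (intro sum.cong) (auto simp: E_def)
      also have "\<dots> = comb E" by (simp add: comb_def Suc E_def)
      finally show ?thesis
        using B eq Suc unfolding S_def by (intro CollectI exI[of _ E]) (auto simp: E_def)
    qed
  qed
  have "F \<in> S"
  proof -
    have "comb (\<lambda>i. if i = 0 then A 0 else 0) = (\<Sum>i\<le>d. if i = 0 then fps_of_poly (A 0) * F else 0)"
      unfolding comb_def by (rule sum.cong) auto
    then have "fps_of_poly (A 0) * F = comb (\<lambda>i. if i = 0 then A 0 else 0)" by simp
    then show ?thesis
      unfolding S_def using N by (intro CollectI exI[of _ "\<lambda>i. if i = 0 then A 0 else 0"]) auto
  qed
  have "Abs_fps (\<lambda>m. F $ (?p ^ l * m + r)) \<in> S" if "r < ?p ^ l" for l r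
    using that
  proof (induction l arbitrary: r)
    case 0
    then show ?case using \<open>F \<in> S\<close> by (simp add: fps_nth_inverse)
  next
    case (Suc l)
    \<comment> \<open>\<open>s\<close> is the leading base-\<open>p\<close> digit of
      \<open>r\<close>: decimation by \<open>p ^ Suc l\<close> is decimation by \<open>p ^ l\<close>
      followed by one Cartier operator.\<close>
    define s where "s = r div ?p ^ l"
    have r: "r = ?p ^ l * s + r mod ?p ^ l" by (simp add: s_def)
    have "s < ?p" using Suc.prems by (simp add: s_def less_mult_imp_div_less)
    have "cartier s (Abs_fps (\<lambda>m. F $ (?p ^ l * m + r mod ?p ^ l))) \<in> S"
      using Suc.IH \<open>s < ?p\<close> S_cartier by simp
    moreover have "cartier s (Abs_fps (\<lambda>m. F $ (?p ^ l * m + r mod ?p ^ l))) = Abs_fps (\<lambda>m. F $ (?p ^ Suc l * m + r))"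
    proof (rule fps_ext)
      fix m
      have "?p ^ l * (?p * m + s) + r mod ?p ^ l = ?p ^ Suc l * m + r"
        by (subst (2) r) (simp add: algebra_simps)
      then show "cartier s (Abs_fps (\<lambda>m. F $ (?p ^ l * m + r mod ?p ^ l))) $ m = Abs_fps (\<lambda>m. F $ (?p ^ Suc l * m + r)) $ m"
        by simp
    qed
    ultimately show ?case by simp
  qed
  then have "{Abs_fps (\<lambda>m. F $ (?p ^ l * m + r)) | l r. r < ?p ^ l} \<subseteq> S" by blast
  then show ?thesis using \<open>finite S\<close> finite_subset by blast
qed

lemma clear_denominators:
  fixes F :: "'a::field fps"
  assumes "\<not> transcendental_over rational_functions (fps_to_fls F)"
  shows "\<exists>n Q. Q n \<noteq> 0 \<and> (\<Sum>j\<le>n. fps_of_poly (Q j) * F ^ j) = 0"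
proof -
  obtain P where P: "P \<noteq> 0" "\<And>i. Polynomial.coeff P i \<in> rational_functions" "poly P (fps_to_fls F) = 0"
    using assms by (auto simp: transcendental_over_def)
  let ?\<iota> = "\<lambda>a. fps_to_fls (fps_of_poly a)"
  have "\<forall>i. \<exists>a b. Polynomial.coeff P i = ?\<iota> a / ?\<iota> b \<and> b \<noteq> 0"
    using P(2) by (fastforce simp: rational_functions_def)
  then obtain a b where ab: "\<And>i. Polynomial.coeff P i = ?\<iota> (a i) / ?\<iota> (b i)" "\<And>i. b i \<noteq> 0" by metis
  define n where "n = Polynomial.degree P"
  \<comment> \<open>Multiplying coefficient \<open>j\<close> by all denominators cancels
    \<open>b j\<close> and keeps the others, so the result is a polynomial.\<close>
  define Q where "Q = (\<lambda>j. a j * (\<Prod>i\<in>{..n} - {j}. b i))"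
  have Q: "?\<iota> (Q j) = ?\<iota> (\<Prod>i\<le>n. b i) * Polynomial.coeff P j" if "j \<le> n" for j
  proof -
    have "(\<Prod>i\<le>n. b i) = b j * (\<Prod>i\<in>{..n} - {j}. b i)"
      using that by (simp add: prod.remove)
    then show ?thesis
      using ab(2)[of j] by (simp add: Q_def ab(1) fps_of_poly_mult fls_times_fps_to_fls)
  qed
  have "a n \<noteq> 0" using P(1) ab(1)[of n] by (auto simp: n_def)
  then have "Q n \<noteq> 0" using ab(2) by (simp add: Q_def)
  moreover have "fps_to_fls (\<Sum>j\<le>n. fps_of_poly (Q j) * F ^ j) = (\<Sum>j\<le>n. ?\<iota> (Q j) * fps_to_fls F ^ j)"
    by (induction n) (simp_all add: fls_times_fps_to_fls fps_to_fls_power)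
  moreover have "\<dots> = ?\<iota> (\<Prod>i\<le>n. b i) * poly P (fps_to_fls F)"
    unfolding poly_altdef n_def[symmetric] sum_distrib_left by (rule sum.cong) (simp_all add: Q mult.assoc)
  ultimately have "Q n \<noteq> 0 \<and> (\<Sum>j\<le>n. fps_of_poly (Q j) * F ^ j) = 0" using P(3) by simp
  then show ?thesis by blast
qed

section \<open>The Liouville function\<close>

lemma liouville_mult: "0 < a \<Longrightarrow> 0 < b \<Longrightarrow> liouville (a * b) = liouville a * liouville b"
  by (simp add: liouville_def big_omega_def prime_factorization_mult power_add)

lemma liouville_prime: "prime p \<Longrightarrow> liouville p = -1"
  by (simp add: liouville_def big_omega_def prime_factorization_prime)

lemma liouville_cases: "liouville n = 1 \<or> liouville n = -1"
  by (simp add: liouville_def minus_one_power_iff)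

lemma liouville_not_automatic:
  assumes "2 \<le> k"
  shows "\<not> automatic k liouville"
proof
  assume aut: "automatic k liouville"
  have "liouville n \<noteq> 0" for n using liouville_cases[of n] by auto
  then obtain K where "gap_invariant liouville K"
    using automatic_imp_gap_invariant[OF assms aut liouville_mult] by blast
  then obtain q where q: "0 < q" "\<And>t. 0 < t \<Longrightarrow> liouville (1 + q * t) = 1"
    using gap_invariant.trivial_on_residue_class_one by blast
  obtain p where p: "prime p" "[p = 1] (mod q)" using exists_prime_cong_1[OF q(1)] by blast
  have "1 < p" using p(1) by (rule prime_gt_1_nat)
  then have "q dvd p - 1" using p(2) by (simp add: cong_altdef_nat)
  then obtain t where t: "p - 1 = q * t" by (auto elim: dvdE)
  with \<open>1 < p\<close> have "p = 1 + q * t" "0 < t" by (auto intro: Nat.gr0I)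
  then have "liouville p = 1" using q(2) by simp
  with liouville_prime[OF p(1)] show False by simp
qed

text \<open>For \<open>p > 2\<close> the residues 1 and -1 differ, so the signs can be read off the
  coefficients. Algebraicity would then make the \<open>p\<close>-kernel of \<open>liouville\<close>
  finite.\<close>

lemma liouville_fps_transcendental:
  assumes card: "CARD('p::prime_card) > 2"
  shows "transcendental_over (rational_functions :: 'p mod_ring fls set) (fps_to_fls liouville_fps)"
proof (rule ccontr)
  let ?p = "CARD('p)"
  let ?F = "liouville_fps :: 'p mod_ring fps"
  assume "\<not> ?thesis"
  then obtain n and Q :: "nat \<Rightarrow> 'p mod_ring poly" where
    "Q n \<noteq> 0" "(\<Sum>j\<le>n. fps_of_poly (Q j) * ?F ^ j) = 0"
    using clear_denominators by blast
  from algebraic_imp_finite_decimations[OF this]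
  have fin: "finite {Abs_fps (\<lambda>m. ?F $ (?p ^ l * m + r)) | l r. r < ?p ^ l}" (is "finite ?D") .
  have "(of_nat 2 :: 'p mod_ring) \<noteq> 0"
    using card by (subst of_nat_eq_0_iff_char_dvd) (auto dest: dvd_imp_le)
  then have ne: "(-1 :: 'p mod_ring) \<noteq> 1"
    by (metis add.right_inverse of_nat_numeral one_add_one)
  define decode :: "'p mod_ring \<Rightarrow> int" where "decode = (\<lambda>x. if x = 1 then 1 else -1)"
  have decode: "decode (?F $ m) = liouville m" if "0 < m" for m
    using that ne liouville_cases[of m] by (auto simp: decode_def liouville_fps_def)
  have "k_kernel ?p liouville \<subseteq> (\<lambda>H. restrict (\<lambda>m. decode (H $ m)) {1..}) ` ?D"
  proof
    fix t assume "t \<in> k_kernel ?p liouville"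
    then obtain l r where t: "t = restrict (\<lambda>m. liouville (?p ^ l * m + r)) {1..}" and r: "r < ?p ^ l"
      by (auto simp: k_kernel_def)
    \<comment> \<open>Only \<open>m \<ge> 1\<close> occurs, so the index
      \<open>p ^ l * m + r\<close> is positive and the coefficient at 0, which was set by hand, is
      never decoded.\<close>
    have "t = restrict (\<lambda>m. decode (Abs_fps (\<lambda>m. ?F $ (?p ^ l * m + r)) $ m)) {1..}"
      unfolding t by (intro restrict_ext) (simp add: decode)
    then show "t \<in> (\<lambda>H. restrict (\<lambda>m. decode (H $ m)) {1..}) ` ?D" using r by blast
  qed
  then have "finite (k_kernel ?p liouville)" using fin finite_subset by blast
  moreover have "finite (liouville ` {1..})"
    by (rule finite_subset[of _ "{1, -1}"]) (use liouville_cases in auto)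
  ultimately have "automatic ?p liouville" by (simp add: automatic_def)
  then show False using liouville_not_automatic[of ?p] card by simp
qed

theorem theorem1p5:
  shows "(\<forall>k\<ge>2. \<not> automatic k liouville) \<and>
    (CARD('p::prime_card) > 2 \<longrightarrow>
      transcendental_over (rational_functions :: 'p mod_ring fls set) (fps_to_fls liouville_fps))"
  using liouville_not_automatic liouville_fps_transcendental by blast

end
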